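(* Let $p>2$ and let $z$ satisfy $z(t)\in L^p(\Omega,\mathbb P)$ for every $t\in[0,T]$ and $\int_0^T\mathbb E[|z(t)|^p]^{2/p}\,dt<+\infty$. Suppose that $z$ is independent of the Brownian motion $W$. Then the minimization problem of finding $\overline u\in L^1(0,T)$ with $$J^{(2)}[\overline u]=\min_{u\in L^1(0,T)}J^{(2)}[u]$$ admits as unique solution $\overline u(t)=\mathbb E[z(t)]$. Moreover, $$J^{(2)}[\overline u]=\frac12\int_0^T\int_0^t\int_0^t e^{2A(t)-A(s)-A(\tau)+t-\max\{s,\tau\}}\,\mathrm{Cov}(z(s),z(\tau))\,ds\,d\tau\,dt,$$ where $\mathrm{Cov}(X,Y)=\mathbb E[(X-\mathbb E[X])(Y-\mathbb E[Y])]$.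
   Context: Fix $T>0$, a filtered probability space $(\Omega,\mathcal F,(\mathcal F_t)_{t\ge 0},\mathbb P)$ and an $\mathcal F_t$-Brownian motion $W$ (started at $0$). $a:[0,T]\to\mathbb R$ is a deterministic function in $L^\infty(0,T)$, $A(t)=\int_0^t a(s)\,ds$, $G(t)=e^{W(t)-t/2}$. $z$ is a real $\mathcal F_t$-adapted, jointly measurable process. $L^1(0,T)$ denotes deterministic integrable real functions (identified when equal a.e.). For $u\in L^1(0,T)$, $$\xi_u(t)=G(t)e^{A(t)}\int_0^t\frac{e^{-A(s)}}{G(s)}(z(s)-u(s))\,ds,\qquad J^{(2)}[u]=\mathbb E\left[\int_0^T\frac{\xi_u(t)^2}{2}\,dt\right].$$ *)

theory Defs
  imports "HOL-Probability.Probability"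
begin

locale filtered_prob_space = prob_space M for M :: "'a measure" +
  fixes F :: "real \<Rightarrow> 'a measure"
  assumes filtration_subalgebra: "0 \<le> t \<Longrightarrow> subalgebra M (F t)"
    and filtration_mono: "0 \<le> s \<Longrightarrow> s \<le> t \<Longrightarrow> sets (F s) \<subseteq> sets (F t)"

text \<open>
  Brownian motion relative to the filtration, started at 0. Values at negative times are irrelevant.
  Note that the second parameter of \<^const>\<open>normal_density\<close> is the standard deviation.
\<close>
locale brownian_motion = filtered_prob_space M F for M :: "'a measure" and F +
  fixes W :: "real \<Rightarrow> 'a \<Rightarrow> real"
  assumes bm_adapted: "0 \<le> t \<Longrightarrow> W t \<in> borel_measurable (F t)"
    and bm_start: "AE \<omega> in M. W 0 \<omega> = 0"
    and bm_indep_increment: "0 \<le> s \<Longrightarrow> s < t \<Longrightarrow>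
      indep_set (sets (F s)) {(\<lambda>\<omega>. W t \<omega> - W s \<omega>) -` B \<inter> space M | B. B \<in> sets borel}"
    and bm_normal_increment: "0 \<le> s \<Longrightarrow> s < t \<Longrightarrow>
      distributed M lborel (\<lambda>\<omega>. W t \<omega> - W s \<omega>) (normal_density 0 (sqrt (t - s)))"
    and bm_continuous_paths: "AE \<omega> in M. continuous_on {0..} (\<lambda>t. W t \<omega>)"

text \<open>
  Representatives of the classes in \<open>L\<^sup>1(0,T)\<close> and \<open>L\<^sup>\<infinity>(0,T)\<close>. They are Lebesgue measurable, not
  necessarily Borel measurable, hence the use of \<^const>\<open>lebesgue\<close> instead of \<^const>\<open>lborel\<close> below.
\<close>
definition L1_fun :: "real \<Rightarrow> (real \<Rightarrow> real) set" where
  "L1_fun T = {u. integrable (lebesgue_on {0..T}) u}"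

definition Linf_fun :: "real \<Rightarrow> (real \<Rightarrow> real) set" where
  "Linf_fun T = {a \<in> borel_measurable (lebesgue_on {0..T}).
     \<exists>C. AE t in lebesgue_on {0..T}. \<bar>a t\<bar> \<le> C}"

definition A_int :: "(real \<Rightarrow> real) \<Rightarrow> real \<Rightarrow> real" where
  "A_int a t = (LINT s:{0..t}|lebesgue. a s)"

definition G_proc :: "(real \<Rightarrow> 'a \<Rightarrow> real) \<Rightarrow> real \<Rightarrow> 'a \<Rightarrow> real" where
  "G_proc W t \<omega> = exp (W t \<omega> - t / 2)"

definition xi_proc :: "(real \<Rightarrow> real) \<Rightarrow> (real \<Rightarrow> 'a \<Rightarrow> real) \<Rightarrow> (real \<Rightarrow> 'a \<Rightarrow> real) \<Rightarrow>
    (real \<Rightarrow> real) \<Rightarrow> real \<Rightarrow> 'a \<Rightarrow> real" where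
  "xi_proc a W z u t \<omega> = G_proc W t \<omega> * exp (A_int a t) *
     (LINT s:{0..t}|lebesgue. exp (- A_int a s) / G_proc W s \<omega> * (z s \<omega> - u s))"

text \<open>The functional may a priori take the value \<open>\<infinity>\<close>.\<close>
definition J2 :: "'a measure \<Rightarrow> real \<Rightarrow> (real \<Rightarrow> real) \<Rightarrow> (real \<Rightarrow> 'a \<Rightarrow> real) \<Rightarrow>
    (real \<Rightarrow> 'a \<Rightarrow> real) \<Rightarrow> (real \<Rightarrow> real) \<Rightarrow> ennreal" where
  "J2 M T a W z u =
     (\<integral>\<^sup>+\<omega>. (\<integral>\<^sup>+t\<in>{0..T}. ennreal ((xi_proc a W z u t \<omega>)\<^sup>2 / 2) \<partial>lebesgue) \<partial>M)"

definition (in prob_space) covariance :: "('a \<Rightarrow> real) \<Rightarrow> ('a \<Rightarrow> real) \<Rightarrow> real" where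
  "covariance X Y = expectation (\<lambda>\<omega>. (X \<omega> - expectation X) * (Y \<omega> - expectation Y))"

end

theory Submission
  imports Defs
begin

text \<open>
  The idea is to turn the stochastic control problem into a deterministic quadratic one. Squaring the
  integral that defines \<open>\<xi>\<^sub>u(t)\<close> gives a double integral over \<open>s, \<tau> \<in> [0, t]\<close>. Its integrand is the product of the
  ratios \<open>G(t)/G(s)\<close> and \<open>G(t)/G(\<tau>)\<close>, which depend on \<open>W\<close> only, of deviations \<open>z(s) - u(s)\<close> and \<open>z(\<tau>) - u(\<tau>)\<close>,
  which depend on \<open>z\<close> only, and of deterministic factors. Fubini's theorem
  (\<open>second_moment_of_integral\<close>), independence and the correlation
  \<open>E[G(t)\<^sup>2 / (G(s) G(\<tau>))] = exp (t - max s \<tau>)\<close> (\<open>G_ratio_correlation\<close>) therefore give, with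
  \<open>k = exp (2 A(t) - A(s) - A(\<tau>) + t - max s \<tau>)\<close>,

  \<open>E[\<xi>\<^sub>u(t)\<^sup>2] = \<integral>\<integral> k E[(z(s) - u(s)) (z(\<tau>) - u(\<tau>))] = \<integral>\<integral> k Cov(z(s), z(\<tau>)) + \<integral>\<integral> k v(s) v(\<tau>)\<close>,

  where \<open>v = E z - u\<close>. The first term does not depend on \<open>u\<close>; half its integral over \<open>t\<close> is the claimed
  minimal value. For the second one, \<open>exp (t - max s \<tau>)\<close> equals \<open>1\<close> plus the integral of \<open>exp (t - r)\<close> over \<open>max s \<tau> \<le> r \<le> t\<close>, so that with
  \<open>w = exp (-A) v\<close> it is

  \<open>exp (2 A(t)) [(\<integral>\<^sub>0\<^sup>t w)\<^sup>2 + \<integral>\<^sub>0\<^sup>t exp (t - r) (\<integral>\<^sub>0\<^sup>r w)\<^sup>2 dr]\<close>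

  (\<open>exp_max_quadratic_form\<close>). This is nonnegative, so \<open>E z\<close> is a minimizer. If its integral over
  \<open>[0, T]\<close> vanishes, then \<open>\<integral>\<^sub>0\<^sup>t w = 0\<close> for almost every, hence by continuity for every \<open>t\<close>, so \<open>w = 0\<close> and
  \<open>u = E z\<close> almost everywhere.

  The interchange of integrals is justified by the estimate that the \<open>L\<^sup>2(\<Omega>)\<close> norm of
  \<open>z(s) - u(s)\<close> is integrable over \<open>s \<in> [0, T]\<close> (\<open>deviation_norm_integrable\<close>).
\<close>

section \<open>Second moments of integrals of random fields\<close>

lemma Cauchy_Schwarz_integral:
  fixes f g :: "'a \<Rightarrow> real"
  assumes [measurable]: "f \<in> borel_measurable M" "g \<in> borel_measurable M"
    and f2: "integrable M (\<lambda>x. (f x)\<^sup>2)" and g2: "integrable M (\<lambda>x. (g x)\<^sup>2)"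
  shows "integrable M (\<lambda>x. f x * g x)"
    and "(LINT x|M. \<bar>f x * g x\<bar>) \<le> sqrt (LINT x|M. (f x)\<^sup>2) * sqrt (LINT x|M. (g x)\<^sup>2)"
proof -
  show int: "integrable M (\<lambda>x. f x * g x)"
  proof (rule Bochner_Integration.integrable_bound)
    show "integrable M (\<lambda>x. (f x)\<^sup>2 + (g x)\<^sup>2)" using f2 g2 by simp
    have "\<bar>a * b\<bar> \<le> a\<^sup>2 + b\<^sup>2" for a b :: real
    proof -
      have "2 * (\<bar>a\<bar> * \<bar>b\<bar>) \<le> a\<^sup>2 + b\<^sup>2"
        using sum_squares_bound[of "\<bar>a\<bar>" "\<bar>b\<bar>"] by simp
      moreover have "0 \<le> \<bar>a\<bar> * \<bar>b\<bar>" by simp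
      ultimately show ?thesis unfolding abs_mult by linarith
    qed
    then show "AE x in M. norm (f x * g x) \<le> norm ((f x)\<^sup>2 + (g x)\<^sup>2)" by simp
  qed simp
  have "ennreal ((LINT x|M. \<bar>f x * g x\<bar>)\<^sup>2) = (\<integral>\<^sup>+x. ennreal \<bar>f x\<bar> * ennreal \<bar>g x\<bar> \<partial>M)\<^sup>2"
    using nn_integral_eq_integral[OF integrable_abs[OF int]]
    by (simp add: ennreal_power[symmetric] abs_mult ennreal_mult')
  also have "\<dots> \<le> (\<integral>\<^sup>+x. (ennreal \<bar>f x\<bar>)\<^sup>2 \<partial>M) * (\<integral>\<^sup>+x. (ennreal \<bar>g x\<bar>)\<^sup>2 \<partial>M)"
    by (rule Cauchy_Schwarz_nn_integral) auto
  also have "\<dots> = ennreal ((LINT x|M. (f x)\<^sup>2) * (LINT x|M. (g x)\<^sup>2))"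
    using f2 g2 by (simp add: ennreal_power nn_integral_eq_integral ennreal_mult)
  finally have "(LINT x|M. \<bar>f x * g x\<bar>)\<^sup>2 \<le> (LINT x|M. (f x)\<^sup>2) * (LINT x|M. (g x)\<^sup>2)"
    by (subst (asm) ennreal_le_iff) auto
  then show "(LINT x|M. \<bar>f x * g x\<bar>) \<le> sqrt (LINT x|M. (f x)\<^sup>2) * sqrt (LINT x|M. (g x)\<^sup>2)"
    unfolding real_sqrt_mult[symmetric] by (rule real_le_rsqrt)
qed

text \<open>
  Minkowski's integral inequality at work: if the \<open>L\<^sup>2\<close> norms of the slices \<open>H s\<close> are integrable in
  \<open>s\<close>, then by Cauchy-Schwarz \<open>H s \<omega> * H \<tau> \<omega>\<close> is integrable over all three variables, so the square of
  the integral may be expanded into a double integral and Fubini's theorem applies. It is used twice: with a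
  probability measure for the state process, and with Lebesgue measure for the quadratic form
  that decides uniqueness.
\<close>

lemma second_moment_of_integral:
  fixes H :: "'b \<Rightarrow> 'a \<Rightarrow> real"
  assumes "sigma_finite_measure N" "sigma_finite_measure M"
    and [measurable]: "case_prod H \<in> borel_measurable (N \<Otimes>\<^sub>M M)"
    and sq: "\<And>s. s \<in> space N \<Longrightarrow> integrable M (\<lambda>\<omega>. (H s \<omega>)\<^sup>2)"
    and norm: "integrable N (\<lambda>s. sqrt (LINT \<omega>|M. (H s \<omega>)\<^sup>2))"
  shows "integrable M (\<lambda>\<omega>. (LINT s|N. H s \<omega>)\<^sup>2)"
    and "(LINT \<omega>|M. (LINT s|N. H s \<omega>)\<^sup>2) = (LINT \<tau>|N. LINT s|N. LINT \<omega>|M. H s \<omega> * H \<tau> \<omega>)"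
proof -
  interpret N: sigma_finite_measure N by fact
  interpret M: sigma_finite_measure M by fact
  interpret NN: pair_sigma_finite N N ..
  interpret NM: pair_sigma_finite N M ..
  interpret P: pair_sigma_finite "N \<Otimes>\<^sub>M N" M ..
  let ?m = "\<lambda>s. sqrt (LINT \<omega>|M. (H s \<omega>)\<^sup>2)"
  have [measurable]: "H s \<in> borel_measurable M" if "s \<in> space N" for s
    using that by measurable
  have int: "integrable ((N \<Otimes>\<^sub>M N) \<Otimes>\<^sub>M M) (\<lambda>p. H (snd (fst p)) (snd p) * H (fst (fst p)) (snd p))"
  proof (rule P.Fubini_integrable)
    show "AE x in N \<Otimes>\<^sub>M N. integrable M (\<lambda>\<omega>. H (snd (fst (x, \<omega>))) (snd (x, \<omega>)) * H (fst (fst (x, \<omega>))) (snd (x, \<omega>)))"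
      by (rule AE_I2) (auto simp: space_pair_measure intro!: Cauchy_Schwarz_integral sq)
    show "integrable (N \<Otimes>\<^sub>M N) (\<lambda>x. LINT \<omega>|M. norm (H (snd (fst (x, \<omega>))) (snd (x, \<omega>)) * H (fst (fst (x, \<omega>))) (snd (x, \<omega>))))"
    proof (rule Bochner_Integration.integrable_bound)
      show "integrable (N \<Otimes>\<^sub>M N) (\<lambda>x. ?m (fst x) * ?m (snd x))"
        by (rule NN.Fubini_integrable) (use norm in \<open>auto simp: abs_mult\<close>)
      show "AE x in N \<Otimes>\<^sub>M N. norm (LINT \<omega>|M. norm (H (snd (fst (x, \<omega>))) (snd (x, \<omega>)) * H (fst (fst (x, \<omega>))) (snd (x, \<omega>)))) \<le> norm (?m (fst x) * ?m (snd x))"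
        using Cauchy_Schwarz_integral(2)[of "H _" M "H _", OF _ _ sq sq]
        by (intro AE_I2) (auto simp: space_pair_measure mult.commute)
    qed measurable
  qed measurable
  \<comment> \<open>Valid for every \<open>\<omega>\<close>: if \<open>H s \<omega>\<close> is not integrable in \<open>s\<close>, both sides are \<open>0\<close>.\<close>
  have sq_eq: "(LINT s|N. H s \<omega>)\<^sup>2 = (LINT \<tau>|N. LINT s|N. H s \<omega> * H \<tau> \<omega>)" for \<omega>
    by (simp add: power2_eq_square)
  have int': "integrable (M \<Otimes>\<^sub>M (N \<Otimes>\<^sub>M N)) (\<lambda>p. H (snd (snd p)) (fst p) * H (fst (snd p)) (fst p))"
    using P.integrable_product_swap[OF int] by (simp add: case_prod_unfold)
  interpret P': pair_sigma_finite M "N \<Otimes>\<^sub>M N" ..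
  let ?D = "\<lambda>\<omega>. LINT x|(N \<Otimes>\<^sub>M N). H (snd x) \<omega> * H (fst x) \<omega>"
  have ae: "AE \<omega> in M. ?D \<omega> = (LINT s|N. H s \<omega>)\<^sup>2"
    using P'.AE_integrable_fst'[OF int']
  proof eventually_elim
    case (elim \<omega>)
    then have "integrable (N \<Otimes>\<^sub>M N) (\<lambda>x. H (snd x) \<omega> * H (fst x) \<omega>)" by simp
    from NN.integral_fst'[OF this] show ?case unfolding sq_eq by simp
  qed
  have mm: "(\<lambda>\<omega>. (LINT s|N. H s \<omega>)\<^sup>2) \<in> borel_measurable M" by measurable
  have mm2: "?D \<in> borel_measurable M" by measurable
  have i1: "integrable M ?D"
    using P'.integrable_fst'[OF int'] by simp
  show "integrable M (\<lambda>\<omega>. (LINT s|N. H s \<omega>)\<^sup>2)"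
    using i1 integrable_cong_AE[OF mm2 mm ae] by blast
  have "(LINT \<omega>|M. (LINT s|N. H s \<omega>)\<^sup>2) = (LINT \<omega>|M. ?D \<omega>)"
    by (rule integral_cong_AE[OF mm mm2]) (use ae in auto)
  also have "\<dots> = (LINT x|(N \<Otimes>\<^sub>M N). LINT \<omega>|M. H (snd x) \<omega> * H (fst x) \<omega>)"
    using P.Fubini_integral[of "\<lambda>x \<omega>. H (snd x) \<omega> * H (fst x) \<omega>"] int
    by (simp add: case_prod_unfold)
  also have "\<dots> = (LINT \<tau>|N. LINT s|N. LINT \<omega>|M. H s \<omega> * H \<tau> \<omega>)"
    using P.integrable_fst'[OF int]
    by (subst NN.integral_fst'[symmetric]) auto
  finally show "(LINT \<omega>|M. (LINT s|N. H s \<omega>)\<^sup>2) = (LINT \<tau>|N. LINT s|N. LINT \<omega>|M. H s \<omega> * H \<tau> \<omega>)" .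
qed

section \<open>Exponential moments of Brownian increments\<close>

text \<open>
  Completing the square: exponential tilting shifts the mean of a normal density.
\<close>

lemma exp_mult_normal_density:
  assumes "\<sigma> > 0"
  shows "exp (c * x) * normal_density 0 \<sigma> x = exp (c\<^sup>2 * \<sigma>\<^sup>2 / 2) * normal_density (c * \<sigma>\<^sup>2) \<sigma> x"
proof -
  have "c * x + - x\<^sup>2 / (2 * \<sigma>\<^sup>2) = c\<^sup>2 * \<sigma>\<^sup>2 / 2 + - (x - c * \<sigma>\<^sup>2)\<^sup>2 / (2 * \<sigma>\<^sup>2)"
    using assms by (simp add: field_simps power2_eq_square)
  then show ?thesis
    unfolding normal_density_def by (simp add: mult.left_commute exp_add[symmetric])
qed

lemma normal_moment_generating:
  assumes X: "distributed M lborel X (normal_density 0 \<sigma>)" and "\<sigma> > 0"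
  shows "integrable M (\<lambda>\<omega>. exp (c * X \<omega>))"
    and "(LINT \<omega>|M. exp (c * X \<omega>)) = exp (c\<^sup>2 * \<sigma>\<^sup>2 / 2)"
proof -
  have "integrable lborel (\<lambda>x. normal_density 0 \<sigma> x * exp (c * x))"
    using exp_mult_normal_density[OF \<open>\<sigma> > 0\<close>, of c] \<open>\<sigma> > 0\<close> by (simp add: mult.commute)
  then show "integrable M (\<lambda>\<omega>. exp (c * X \<omega>))"
    by (subst (asm) distributed_integrable[OF X]) auto
  have "(LINT \<omega>|M. exp (c * X \<omega>)) = (LBINT x. normal_density 0 \<sigma> x * exp (c * x))"
    by (rule distributed_integral[OF X, symmetric]) auto
  also have "\<dots> = exp (c\<^sup>2 * \<sigma>\<^sup>2 / 2)"
    using exp_mult_normal_density[OF \<open>\<sigma> > 0\<close>, of c] \<open>\<sigma> > 0\<close> by (simp add: mult.commute)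
  finally show "(LINT \<omega>|M. exp (c * X \<omega>)) = exp (c\<^sup>2 * \<sigma>\<^sup>2 / 2)" .
qed

context brownian_motion
begin

lemma exp_increment:
  assumes "0 \<le> s" "s \<le> t"
  shows "integrable M (\<lambda>\<omega>. exp (c * (W t \<omega> - W s \<omega>)))"
    and "expectation (\<lambda>\<omega>. exp (c * (W t \<omega> - W s \<omega>))) = exp (c\<^sup>2 * (t - s) / 2)"
proof -
  have "integrable M (\<lambda>\<omega>. exp (c * (W t \<omega> - W s \<omega>))) \<and>
     expectation (\<lambda>\<omega>. exp (c * (W t \<omega> - W s \<omega>))) = exp (c\<^sup>2 * (t - s) / 2)"
  proof (cases "s = t")
    case True
    then show ?thesis by (simp add: prob_space)
  next
    case False
    then have "s < t" using assms by simp
    then show ?thesis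
      using normal_moment_generating[OF bm_normal_increment[OF \<open>0 \<le> s\<close> \<open>s < t\<close>], of c] by simp
  qed
  then show "integrable M (\<lambda>\<omega>. exp (c * (W t \<omega> - W s \<omega>)))"
    and "expectation (\<lambda>\<omega>. exp (c * (W t \<omega> - W s \<omega>))) = exp (c\<^sup>2 * (t - s) / 2)" by auto
qed

lemma W_measurable: "0 \<le> t \<Longrightarrow> W t \<in> borel_measurable M"
  using bm_adapted[of t] filtration_subalgebra[of t] measurable_from_subalg by blast

lemma increment_indep_adapted:
  assumes "0 \<le> r" "r < t" and Y: "Y \<in> borel_measurable (F r)"
  shows "indep_var borel Y borel (\<lambda>\<omega>. W t \<omega> - W r \<omega>)"
  unfolding indep_var_eq
proof (intro conjI)
  have sub: "subalgebra M (F r)" using filtration_subalgebra[OF \<open>0 \<le> r\<close>] .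
  then show "random_variable borel Y" using Y measurable_from_subalg by blast
  show "random_variable borel (\<lambda>\<omega>. W t \<omega> - W r \<omega>)"
    using W_measurable[of t] W_measurable[of r] assms by simp
  have sp: "space (F r) = space M" using sub by (simp add: subalgebra_def)
  have 1: "sigma_sets (space M) {Y -` A \<inter> space M |A. A \<in> sets borel} \<subseteq> sets (F r)"
    using Y by (subst sp[symmetric], intro sets.sigma_sets_subset) (auto simp: sp dest: measurable_sets)
  have 2: "sigma_sets (space M) {(\<lambda>\<omega>. W t \<omega> - W r \<omega>) -` A \<inter> space M |A. A \<in> sets borel}
      = {(\<lambda>\<omega>. W t \<omega> - W r \<omega>) -` A \<inter> space M |A. A \<in> sets borel}"
    using sigma_sets_vimage_commute[of "\<lambda>\<omega>. W t \<omega> - W r \<omega>" "space M" "space borel" "sets borel"]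
      by (simp add: Pi_def sets.sigma_sets_eq[of borel, simplified])
  show "indep_set (sigma_sets (space M) {Y -` A \<inter> space M |A. A \<in> sets borel})
     (sigma_sets (space M) {(\<lambda>\<omega>. W t \<omega> - W r \<omega>) -` A \<inter> space M |A. A \<in> sets borel})"
    unfolding 2 indep_set_def
    by (rule indep_sets_mono_sets[OF bm_indep_increment[OF assms(1,2), unfolded indep_set_def]])
      (use 1 in \<open>auto split: bool.split\<close>)
qed

text \<open>
  For \<open>r < t\<close> the second factor is independent of \<open>F r\<close>, and the first one is measurable with respect to it.
\<close>

lemma exp_two_increments:
  assumes "0 \<le> s" "s \<le> r" "r \<le> t"
  shows "integrable M (\<lambda>\<omega>. exp (d * (W r \<omega> - W s \<omega>)) * exp (c * (W t \<omega> - W r \<omega>)))"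
    and "expectation (\<lambda>\<omega>. exp (d * (W r \<omega> - W s \<omega>)) * exp (c * (W t \<omega> - W r \<omega>)))
      = exp (c\<^sup>2 * (t - r) / 2 + d\<^sup>2 * (r - s) / 2)"
proof -
  have "integrable M (\<lambda>\<omega>. exp (d * (W r \<omega> - W s \<omega>)) * exp (c * (W t \<omega> - W r \<omega>))) \<and>
    expectation (\<lambda>\<omega>. exp (d * (W r \<omega> - W s \<omega>)) * exp (c * (W t \<omega> - W r \<omega>)))
      = exp (c\<^sup>2 * (t - r) / 2 + d\<^sup>2 * (r - s) / 2)"
  proof (cases "r = t")
    case True
    then show ?thesis using exp_increment[OF assms(1,2), of d] by simp
  next
    case False
    have "W s \<in> borel_measurable (F r)"
      using bm_adapted[of s] filtration_mono[of s r] filtration_subalgebra[of s] filtration_subalgebra[of r] assms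
      by (auto simp: subalgebra_def measurable_def)
    then have "(\<lambda>\<omega>. exp (d * (W r \<omega> - W s \<omega>))) \<in> borel_measurable (F r)"
      using bm_adapted[of r] assms by simp
    from increment_indep_adapted[OF _ _ this] False assms
    have "indep_var borel (\<lambda>\<omega>. exp (d * (W r \<omega> - W s \<omega>))) borel (\<lambda>\<omega>. W t \<omega> - W r \<omega>)" by simp
    from indep_var_compose[OF this, of "\<lambda>x. x" borel "\<lambda>x. exp (c * x)" borel]
    have ind: "indep_var borel (\<lambda>\<omega>. exp (d * (W r \<omega> - W s \<omega>))) borel (\<lambda>\<omega>. exp (c * (W t \<omega> - W r \<omega>)))"
      by (simp add: comp_def)
    show ?thesis
      using indep_var_integrable[OF ind] indep_var_lebesgue_integral[OF ind]
        exp_increment[of r t c] exp_increment[of s r d] assms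
      by (simp add: exp_add mult.commute)
  qed
  then show "integrable M (\<lambda>\<omega>. exp (d * (W r \<omega> - W s \<omega>)) * exp (c * (W t \<omega> - W r \<omega>)))"
    and "expectation (\<lambda>\<omega>. exp (d * (W r \<omega> - W s \<omega>)) * exp (c * (W t \<omega> - W r \<omega>)))
      = exp (c\<^sup>2 * (t - r) / 2 + d\<^sup>2 * (r - s) / 2)" by auto
qed

abbreviation ratio :: "real \<Rightarrow> real \<Rightarrow> 'a \<Rightarrow> real" where
  "ratio t s \<omega> \<equiv> G_proc W t \<omega> / G_proc W s \<omega>"

text \<open>
  For \<open>s \<le> \<tau> \<le> t\<close> the exponent of the product is \<open>2 (W\<^sub>t - W\<^sub>\<tau>) + (W\<^sub>\<tau> - W\<^sub>s) - (t - \<tau>) - (\<tau> - s)/2\<close>. The normal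
  moment generating function contributes \<open>2 (t - \<tau>) + (\<tau> - s)/2\<close>, so the part between \<open>s\<close> and \<open>\<tau>\<close>
  cancels and \<open>t - \<tau>\<close> remains.
\<close>

lemma G_ratio_correlation:
  assumes "0 \<le> s" "0 \<le> \<tau>" "s \<le> t" "\<tau> \<le> t"
  shows "integrable M (\<lambda>\<omega>. ratio t s \<omega> * ratio t \<tau> \<omega>)"
    and "expectation (\<lambda>\<omega>. ratio t s \<omega> * ratio t \<tau> \<omega>) = exp (t - max s \<tau>)"
proof -
  have *: "integrable M (\<lambda>\<omega>. ratio t s \<omega> * ratio t r \<omega>) \<and>
     expectation (\<lambda>\<omega>. ratio t s \<omega> * ratio t r \<omega>) = exp (t - r)"
    if "0 \<le> s" "s \<le> r" "r \<le> t" for s r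
  proof -
    have eq: "ratio t s \<omega> * ratio t r \<omega> = exp (- (t - r) - (r - s) / 2) *
        (exp (1 * (W r \<omega> - W s \<omega>)) * exp (2 * (W t \<omega> - W r \<omega>)))" for \<omega>
      unfolding G_proc_def exp_diff[symmetric] exp_add[symmetric] 
      by (simp add: field_simps)
    have "exp (- (t - r) - (r - s) / 2) * exp (2\<^sup>2 * (t - r) / 2 + 1\<^sup>2 * (r - s) / 2) = exp (t - r)"
      unfolding exp_add[symmetric] by (simp add: field_simps)
    then show ?thesis
      unfolding eq integral_mult_right_zero exp_two_increments(2)[OF that, of 1 2]
      using integrable_mult_right[OF exp_two_increments(1)[OF that, of 1 2]] by blast
  qed
  show "integrable M (\<lambda>\<omega>. ratio t s \<omega> * ratio t \<tau> \<omega>)"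
    and "expectation (\<lambda>\<omega>. ratio t s \<omega> * ratio t \<tau> \<omega>) = exp (t - max s \<tau>)"
    using linear[of s \<tau>] *[of s \<tau>] *[of \<tau> s] assms
    by (auto simp: max_def mult.commute)
qed

end

section \<open>A jointly measurable modification\<close>

text \<open>
  The process is the pointwise limit of its discretisations at the times \<open>\<lfloor>(n + 1) t\<rfloor> / (n + 1)\<close>, each of
  which takes countably many values in the time variable.
\<close>

lemma borel_measurable_continuous_paths:
  fixes X :: "real \<Rightarrow> 'a \<Rightarrow> real"
  assumes [measurable]: "\<And>t. X t \<in> borel_measurable M"
    and cont: "\<And>\<omega>. \<omega> \<in> space M \<Longrightarrow> continuous_on UNIV (\<lambda>t. X t \<omega>)"
  shows "case_prod X \<in> borel_measurable (borel \<Otimes>\<^sub>M M)"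
proof (rule borel_measurable_LIMSEQ_real)
  let ?d = "\<lambda>n t. of_int \<lfloor>real (Suc n) * t\<rfloor> / real (Suc n)"
  show "(\<lambda>p. X (?d n (fst p)) (snd p)) \<in> borel_measurable (borel \<Otimes>\<^sub>M M)" for n
    by (rule measurable_compose_countable[where f="\<lambda>i p. X (of_int i / real (Suc n)) (snd p)"]) measurable
  show "(\<lambda>n. X (?d n (fst p)) (snd p)) \<longlonglongrightarrow> case_prod X p" if "p \<in> space (borel \<Otimes>\<^sub>M M)" for p
  proof -
    have "(\<lambda>n. ?d n (fst p)) \<longlonglongrightarrow> fst p"
    proof (rule tendsto_sandwich)
      show "(\<lambda>n. fst p - 1 / real (Suc n)) \<longlonglongrightarrow> fst p"
        using LIMSEQ_inverse_real_of_nat_add_minus[of "fst p"] by (simp add: inverse_eq_divide)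
      have "real (Suc n) * (fst p - 1 / real (Suc n)) \<le> of_int \<lfloor>real (Suc n) * fst p\<rfloor>" for n
        using floor_correct[of "real (Suc n) * fst p"] by (simp add: right_diff_distrib)
      then show "\<forall>\<^sub>F n in sequentially. fst p - 1 / real (Suc n) \<le> ?d n (fst p)"
        by (simp add: pos_le_divide_eq mult.commute)
      show "\<forall>\<^sub>F n in sequentially. ?d n (fst p) \<le> fst p"
        by (simp add: pos_divide_le_eq mult.commute)
    qed simp
    moreover have "isCont (\<lambda>t. X t (snd p)) (fst p)"
      using cont[of "snd p"] that by (auto simp: space_pair_measure continuous_on_eq_continuous_at)
    ultimately show ?thesis
      using isCont_tendsto_compose[of "fst p" "\<lambda>t. X t (snd p)"] by (simp add: case_prod_unfold)
  qed
qed

text \<open>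
  Fubini's theorem needs a jointly measurable process, but the paths of \<open>W\<close> are continuous only
  outside a null set and \<open>M\<close> need not be complete. Setting the exceptional paths to \<open>0\<close> and freezing
  negative times at \<open>0\<close> repairs this; at nonnegative times it changes \<open>W\<close> on a null set only.
\<close>

lemma (in brownian_motion) continuous_modification:
  obtains V where "case_prod V \<in> borel_measurable (borel \<Otimes>\<^sub>M M)"
    and "AE \<omega> in M. \<forall>t\<ge>0. V t \<omega> = W t \<omega>"
proof -
  obtain N where N: "{\<omega> \<in> space M. \<not> continuous_on {0..} (\<lambda>t. W t \<omega>)} \<subseteq> N" "N \<in> null_sets M"
    using bm_continuous_paths by (auto elim!: AE_E simp: null_sets_def)
  define V where "V t \<omega> = (if \<omega> \<in> N then 0 else W (max 0 t) \<omega>)" for t \<omega>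
  have [measurable]: "W t \<in> borel_measurable M" if "0 \<le> t" for t
    using W_measurable that .
  have [measurable]: "N \<in> sets M" using N by auto
  show ?thesis
  proof (rule that)
    show "case_prod V \<in> borel_measurable (borel \<Otimes>\<^sub>M M)"
    proof (rule borel_measurable_continuous_paths)
      show "V t \<in> borel_measurable M" for t unfolding V_def by measurable
      show "continuous_on UNIV (\<lambda>t. V t \<omega>)" if "\<omega> \<in> space M" for \<omega>
      proof (cases "\<omega> \<in> N")
        case False
        then have "continuous_on {0..} (\<lambda>t. W t \<omega>)" using N that by auto
        then have "continuous_on UNIV (\<lambda>t. W (max 0 t) \<omega>)"
          by (rule continuous_on_compose2) (auto intro!: continuous_intros)
        with False show ?thesis by (simp add: V_def)
      qed (simp add: V_def)
    qed
    show "AE \<omega> in M. \<forall>t\<ge>0. V t \<omega> = W t \<omega>"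
      using AE_not_in[OF N(2)] by eventually_elim (simp add: V_def)
  qed
qed

section \<open>A nonnegative quadratic form\<close>

lemma integrable_dominated_by_product:
  fixes f :: "real \<times> real \<Rightarrow> real" and g :: "real \<Rightarrow> real"
  assumes "f \<in> borel_measurable (lborel \<Otimes>\<^sub>M lborel)" and g: "integrable lborel g"
    and le: "\<And>\<tau> s. \<bar>f (\<tau>, s)\<bar> \<le> C * (g \<tau> * g s)"
  shows "integrable (lborel \<Otimes>\<^sub>M lborel) f"
proof (rule Bochner_Integration.integrable_bound)
  have [measurable]: "g \<in> borel_measurable borel" using g by auto
  show "integrable (lborel \<Otimes>\<^sub>M lborel) (\<lambda>x. C * (g (fst x) * g (snd x)))"
    by (rule lborel_pair.Fubini_integrable) (use g in \<open>auto simp: abs_mult\<close>)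
  show "AE x in lborel \<Otimes>\<^sub>M lborel. norm (f x) \<le> norm (C * (g (fst x) * g (snd x)))"
    using le by (intro AE_I2) (auto intro: order_trans[OF _ abs_ge_self])
qed fact

lemma double_integral_add:
  fixes f g :: "real \<times> real \<Rightarrow> real"
  assumes f: "integrable (lborel \<Otimes>\<^sub>M lborel) f" and g: "integrable (lborel \<Otimes>\<^sub>M lborel) g"
  shows "(LBINT \<tau>. LBINT s. f (\<tau>, s) + g (\<tau>, s)) = (LBINT \<tau>. LBINT s. f (\<tau>, s)) + (LBINT \<tau>. LBINT s. g (\<tau>, s))"
  using lborel_pair.integral_fst'[OF Bochner_Integration.integrable_add[OF f g]]
    lborel_pair.integral_fst'[OF f] lborel_pair.integral_fst'[OF g]
    Bochner_Integration.integral_add[OF f g]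
  by simp

text \<open>
  Behind the identity is \<open>exp (t - max s \<tau>) = 1 + \<integral> exp (t - r) dr\<close> over \<open>max s \<tau> \<le> r \<le> t\<close>. The \<open>1\<close> yields
  the square of the integral of \<open>w\<close>. In the remaining term the condition \<open>max s \<tau> \<le> r\<close> factors into
  \<open>s \<le> r\<close> and \<open>\<tau> \<le> r\<close>, so interchanging the integrals yields a square for each \<open>r\<close>. Since this expresses
  the form as a sum of squares, it is positive definite.
\<close>

lemma exp_max_quadratic_form:
  fixes w :: "real \<Rightarrow> real"
  assumes w: "integrable lborel w"
  shows "(LBINT \<tau>:{0..t}. LBINT s:{0..t}. exp (t - max s \<tau>) * (w s * w \<tau>))
    = (LBINT s:{0..t}. w s)\<^sup>2 + (LBINT r:{0..t}. exp (t - r) * (LBINT s:{0..r}. w s)\<^sup>2)"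
proof -
  have [measurable]: "w \<in> borel_measurable borel" using w by auto
  \<comment> \<open>The factor \<open>1/2\<close> in the exponent makes \<open>H s r * H \<tau> r\<close> carry the weight \<open>exp (t - r)\<close>.\<close>
  define H where "H s r = (if 0 \<le> s \<and> s \<le> r \<and> r \<le> t then exp ((t - r) / 2) * w s else 0)" for s r
  have [measurable]: "case_prod H \<in> borel_measurable (lborel \<Otimes>\<^sub>M lborel)"
    unfolding H_def by measurable
  have HH_eq: "H s r * H \<tau> r = indicator {0..t} s * indicator {0..t} \<tau> * w s * w \<tau> *
      (exp (t - r) * indicator {max s \<tau>..t} r)" for s \<tau> r
    by (auto simp: H_def indicator_def exp_add[symmetric] max_def)
  have bi: "has_bochner_integral lborel (\<lambda>r. exp (t - r) * indicator {m..t} r) (exp (t - m) - 1)"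
    if "m \<le> t" for m
  proof -
    have "has_bochner_integral lborel (\<lambda>r. exp (t - r) * indicator {m..t} r) (- exp (t - t) - (- exp (t - m)))"
      by (rule has_bochner_integral_FTC_Icc_real[OF that])
        (auto intro!: derivative_eq_intros continuous_intros)
    then show ?thesis by simp
  qed
  have HH: "has_bochner_integral lborel (\<lambda>r. H s r * H \<tau> r)
      (indicator {0..t} s * indicator {0..t} \<tau> * (w s * w \<tau>) * (exp (t - max s \<tau>) - 1))" for s \<tau>
  proof (cases "max s \<tau> \<le> t")
    case True
    show ?thesis
      unfolding HH_eq
      using has_bochner_integral_mult_right[OF bi[OF True], of "indicator {0..t} s * indicator {0..t} \<tau> * w s * w \<tau>"]
      by (simp add: mult.assoc)
  next
    case False
    then have "(\<lambda>r. H s r * H \<tau> r) = (\<lambda>r. 0)"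
      by (auto simp: H_def max_def split: if_splits)
    moreover have "indicator {0..t} s * indicator {0..t} \<tau> = (0::real)"
      using False by (auto simp: indicator_def max_def split: if_splits)
    ultimately show ?thesis by (simp only: mult_zero_left has_bochner_integral_zero)
  qed
  have sq: "integrable lborel (\<lambda>r. (H s r)\<^sup>2)" for s
    using HH[of s s] by (simp add: power2_eq_square has_bochner_integral_iff)
  have nrm: "integrable lborel (\<lambda>s. sqrt (LBINT r. (H s r)\<^sup>2))"
  proof (rule Bochner_Integration.integrable_bound)
    show "integrable lborel (\<lambda>s. exp t * w s)" using w by simp
    show "AE s in lborel. norm (sqrt (LBINT r. (H s r)\<^sup>2)) \<le> norm (exp t * w s)"
    proof (rule AE_I2)
      fix s :: real
      have "(LBINT r. (H s r)\<^sup>2) \<le> (exp t * w s)\<^sup>2" 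
      proof (cases "0 \<le> s \<and> s \<le> t")
        case True
        have "(LBINT r. (H s r)\<^sup>2) = (exp (t - s) - 1) * (w s)\<^sup>2"
          using HH[of s s] True by (simp add: power2_eq_square has_bochner_integral_iff)
        also have "\<dots> \<le> (exp t)\<^sup>2 * (w s)\<^sup>2"
        proof (rule mult_right_mono)
          have "exp (t - s) - 1 \<le> exp (t - s)" by simp
          also have "\<dots> \<le> exp (2 * t)" using True by simp
          finally show "exp (t - s) - 1 \<le> (exp t)\<^sup>2" by (simp add: exp_double)
        qed simp
        finally show ?thesis by (simp add: power_mult_distrib)
      next
        case False
        then have "H s = (\<lambda>r. 0)" by (auto simp: H_def)
        then show ?thesis by simp
      qed
      then have "sqrt (LBINT r. (H s r)\<^sup>2) \<le> \<bar>exp t * w s\<bar>"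
        by (metis real_sqrt_abs real_sqrt_le_iff)
      then show "norm (sqrt (LBINT r. (H s r)\<^sup>2)) \<le> norm (exp t * w s)"
        by (simp add: integral_nonneg)
    qed
  qed measurable
  have "(LBINT r. (LBINT s. H s r)\<^sup>2) = (LBINT \<tau>. LBINT s. LBINT r. H s r * H \<tau> r)"
    by (rule second_moment_of_integral(2)[OF _ _ _ sq nrm]) (auto intro: sigma_finite_lborel)
  moreover have "(LBINT s. H s r) = indicator {0..t} r * exp ((t - r) / 2) * (LBINT s:{0..r}. w s)" for r
    unfolding set_lebesgue_integral_def
    by (subst integral_mult_right_zero[symmetric], intro Bochner_Integration.integral_cong)
      (auto simp: H_def indicator_def)
  then have "(LBINT s. H s r)\<^sup>2 = indicator {0..t} r * (exp (t - r) * (LBINT s:{0..r}. w s)\<^sup>2)" for r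
    by (auto simp: power_mult_distrib indicator_def exp_double[symmetric])
  ultimately have "(LBINT r:{0..t}. exp (t - r) * (LBINT s:{0..r}. w s)\<^sup>2)
      = (LBINT \<tau>. LBINT s. indicator {0..t} s * indicator {0..t} \<tau> * (w s * w \<tau>) * (exp (t - max s \<tau>) - 1))"
    using HH by (simp add: set_lebesgue_integral_def has_bochner_integral_iff)
  moreover have "(LBINT s:{0..t}. w s)\<^sup>2 = (LBINT \<tau>. LBINT s. (indicator {0..t} s * w s) * (indicator {0..t} \<tau> * w \<tau>))"
    by (simp add: power2_eq_square set_lebesgue_integral_def)
  moreover have "(LBINT \<tau>. LBINT s. indicator {0..t} s * indicator {0..t} \<tau> * (w s * w \<tau>) * (exp (t - max s \<tau>) - 1))
      + (LBINT \<tau>. LBINT s. (indicator {0..t} s * w s) * (indicator {0..t} \<tau> * w \<tau>))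
    = (LBINT \<tau>. LBINT s. indicator {0..t} \<tau> * (indicator {0..t} s * (exp (t - max s \<tau>) * (w s * w \<tau>))))"
  proof -
    let ?p = "\<lambda>x. indicator {0..t} (snd x) * indicator {0..t} (fst x) * (w (snd x) * w (fst x)) * (exp (t - max (snd x) (fst x)) - 1)"
    let ?q = "\<lambda>x. (indicator {0..t} (snd x) * w (snd x)) * (indicator {0..t} (fst x) * w (fst x))"
    have p: "integrable (lborel \<Otimes>\<^sub>M lborel) ?p"
    proof (rule integrable_dominated_by_product)
      show "integrable lborel (\<lambda>s. \<bar>w s\<bar>)" using w by simp
      have *: "\<bar>exp (t - max s \<tau>) - 1\<bar> \<le> exp t" if "0 \<le> s" "s \<le> t" "\<tau> \<le> t" for s \<tau>
      proof -
        have "1 \<le> exp (t - max s \<tau>)" "exp (t - max s \<tau>) \<le> exp t" using that by auto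
        then show ?thesis by linarith
      qed
      show "\<bar>?p (\<tau>, s)\<bar> \<le> exp t * (\<bar>w \<tau>\<bar> * \<bar>w s\<bar>)" for \<tau> s
        using mult_left_mono[OF *[of s \<tau>], of "\<bar>w s\<bar> * \<bar>w \<tau>\<bar>"]
        by (auto simp: indicator_def abs_mult mult.commute)
    qed measurable
    have q: "integrable (lborel \<Otimes>\<^sub>M lborel) ?q"
    proof (rule integrable_dominated_by_product)
      show "integrable lborel (\<lambda>s. \<bar>w s\<bar>)" using w by simp
      show "\<bar>?q (\<tau>, s)\<bar> \<le> 1 * (\<bar>w \<tau>\<bar> * \<bar>w s\<bar>)" for \<tau> s
        by (auto simp: indicator_def abs_mult)
    qed measurable
    have "?p (\<tau>, s) + ?q (\<tau>, s) = indicator {0..t} \<tau> * (indicator {0..t} s * (exp (t - max s \<tau>) * (w s * w \<tau>)))" for \<tau> s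
      by (simp add: algebra_simps)
    then show ?thesis using double_integral_add[OF p q] by simp
  qed
  ultimately show ?thesis
    by (simp add: set_lebesgue_integral_def)
qed

text \<open>
  The positive and the negative part of \<open>w\<close> are densities of two finite measures that agree on the
  half lines \<open>{t<..}\<close>, a generator of the Borel sets that is stable under intersection.
\<close>

lemma AE_zero_if_integrals_zero:
  fixes w :: "real \<Rightarrow> real"
  assumes w: "integrable lborel w" and zero: "\<And>t. (LBINT s:{t<..}. w s) = 0"
  shows "AE s in lborel. w s = 0"
proof -
  have [measurable]: "w \<in> borel_measurable borel" using w by auto
  have ip: "set_integrable lborel {t<..} (\<lambda>s. max 0 (w s))" and im: "set_integrable lborel {t<..} (\<lambda>s. max 0 (- w s))" for t
    unfolding set_integrable_def using w by (intro integrable_mult_indicator; simp)+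
  have eq: "(LBINT s:{t<..}. max 0 (w s)) = (LBINT s:{t<..}. max 0 (- w s))" for t
  proof -
    have "w s = max 0 (w s) - max 0 (- w s)" for s by (simp add: max_def)
    then show ?thesis using zero[of t] set_integral_diff(2)[OF ip[of t] im[of t]] by simp
  qed
  have em: "emeasure (density lborel (\<lambda>s. ennreal (f s))) {t<..} = ennreal (LBINT s:{t<..}. f s)"
    if [measurable]: "f \<in> borel_measurable borel" and "\<And>s. 0 \<le> f s" and "set_integrable lborel {t<..} f" for f :: "real \<Rightarrow> real" and t
  proof -
    have "emeasure (density lborel (\<lambda>s. ennreal (f s))) {t<..} = (\<integral>\<^sup>+s. ennreal (indicator {t<..} s * f s) \<partial>lborel)"
      by (subst emeasure_density) (auto intro!: nn_integral_cong simp: indicator_def)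
    then show ?thesis
      using that by (subst (asm) nn_integral_eq_integral) (auto simp: set_integrable_def set_lebesgue_integral_def)
  qed
  have "density lborel (\<lambda>s. ennreal (max 0 (w s))) = density lborel (\<lambda>s. ennreal (max 0 (- w s)))"
  proof (rule measure_eqI_lessThan)
    show "emeasure (density lborel (\<lambda>s. ennreal (max 0 (w s)))) {t<..} < \<infinity>"
      and "emeasure (density lborel (\<lambda>s. ennreal (max 0 (w s)))) {t<..} = emeasure (density lborel (\<lambda>s. ennreal (max 0 (- w s)))) {t<..}" for t
      using em[OF _ _ ip[of t]] em[OF _ _ im[of t]] eq[of t] by auto
  qed auto
  then have "AE s in lborel. ennreal (max 0 (w s)) = ennreal (max 0 (- w s))"
    by (subst (asm) sigma_finite_measure.density_unique_iff[OF sigma_finite_lborel]) auto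
  then show ?thesis
    by eventually_elim (auto simp: max_def split: if_splits)
qed

text \<open>
  The set of interior points where \<open>f\<close> does not vanish is open and null, hence empty; the end points follow
  by continuity.
\<close>

lemma continuous_AE_zero:
  fixes f :: "real \<Rightarrow> real"
  assumes cont: "continuous_on {a..b} f" and "a < b" and ae: "AE t in lborel. t \<in> {a..b} \<longrightarrow> f t = 0"
    and "t \<in> {a..b}"
  shows "f t = 0"
proof -
  let ?U = "{t \<in> {a<..<b}. f t \<noteq> 0}"
  have "continuous_on {a<..<b} f" using cont by (rule continuous_on_subset) auto
  then have "open ({a<..<b} \<inter> f -` (- {0}))"
    by (rule continuous_open_preimage) auto
  moreover have "{a<..<b} \<inter> f -` (- {0}) = ?U" by auto
  ultimately have o: "open ?U" by simp
  then have "?U \<in> sets lborel" by simp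
  then have null: "?U \<in> null_sets lborel"
    using ae by (subst AE_iff_null_sets) (auto elim: eventually_mono)
  have z: "f t = 0" if "t \<in> {a<..<b}" for t
  proof (rule ccontr)
    assume "f t \<noteq> 0"
    then have "t \<in> ?U" using that by simp
    then obtain e where e: "e > 0" "cball t e \<subseteq> ?U"
      using open_contains_cball_eq[OF o] by blast
    then have "{t - e..t + e} \<in> null_sets lborel"
      using null_sets_subset[OF null, of "cball t e"] by (simp add: cball_eq_atLeastAtMost)
    then have "ennreal (2 * e) = 0" using e by (auto simp: null_sets_def)
    with e show False by simp
  qed
  show ?thesis
    by (rule continuous_constant_on_closure[of "{a<..<b}" f 0]) (use cont z assms in auto)
qed

section \<open>The second moment of the state for independent noise\<close>

context brownian_motion
begin

lemma expectation_ratio_mult: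
  assumes "0 \<le> s" "0 \<le> \<tau>" "s \<le> t" "\<tau> \<le> t" and Y: "integrable M Y"
    and indep: "indep_var borel Y borel (\<lambda>\<omega>. ratio t s \<omega> * ratio t \<tau> \<omega>)"
  shows "integrable M (\<lambda>\<omega>. Y \<omega> * (ratio t s \<omega> * ratio t \<tau> \<omega>))"
    and "expectation (\<lambda>\<omega>. Y \<omega> * (ratio t s \<omega> * ratio t \<tau> \<omega>)) = exp (t - max s \<tau>) * expectation Y"
  using indep_var_integrable[OF indep Y G_ratio_correlation(1)[OF assms(1-4)]]
    indep_var_lebesgue_integral[OF indep Y G_ratio_correlation(1)[OF assms(1-4)]]
    G_ratio_correlation(2)[OF assms(1-4)]
  by (simp_all add: mult.commute)

text \<open>
  The heart of the reduction, for an arbitrary random input \<open>y\<close> in place of \<open>z - u\<close>. The process \<open>V\<close>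
  stands for a jointly measurable version of \<open>W\<close>. Independence enters through the products of
  two values, since only these occur after squaring.
\<close>

lemma second_moment_of_state:
  fixes y V :: "real \<Rightarrow> 'a \<Rightarrow> real" and A :: "real \<Rightarrow> real"
  assumes V[measurable]: "case_prod V \<in> borel_measurable (borel \<Otimes>\<^sub>M M)"
    and VW: "AE \<omega> in M. \<forall>t\<ge>0. V t \<omega> = W t \<omega>"
    and A[measurable]: "A \<in> borel_measurable borel" and AB: "\<And>s. \<bar>A s\<bar> \<le> B"
    and y[measurable]: "case_prod y \<in> borel_measurable (borel \<Otimes>\<^sub>M M)"
    and y2: "\<And>s. integrable M (\<lambda>\<omega>. (y s \<omega>)\<^sup>2)"
    and nrm: "set_integrable lborel {0..t} (\<lambda>s. sqrt (expectation (\<lambda>\<omega>. (y s \<omega>)\<^sup>2)))"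
    and indep: "\<And>s \<tau>. s \<in> {0..t} \<Longrightarrow> \<tau> \<in> {0..t} \<Longrightarrow>
        indep_var borel (\<lambda>\<omega>. y s \<omega> * y \<tau> \<omega>) borel (\<lambda>\<omega>. ratio t s \<omega> * ratio t \<tau> \<omega>)"
    and "0 \<le> t"
  defines "\<xi> \<equiv> \<lambda>\<omega>. G_proc V t \<omega> * exp (A t) * (LBINT s:{0..t}. exp (- A s) / G_proc V s \<omega> * y s \<omega>)"
  shows "integrable M (\<lambda>\<omega>. (\<xi> \<omega>)\<^sup>2)"
    and "expectation (\<lambda>\<omega>. (\<xi> \<omega>)\<^sup>2) = (LBINT \<tau>:{0..t}. LBINT s:{0..t}.
        exp (2 * A t - A s - A \<tau> + t - max s \<tau>) * expectation (\<lambda>\<omega>. y s \<omega> * y \<tau> \<omega>))"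
proof -
  have [measurable]: "y s \<in> borel_measurable M" for s by measurable
  have [measurable]: "V s \<in> borel_measurable M" for s by measurable
  define H where "H s \<omega> = indicator {0..t} s * (exp (A t - A s) * (G_proc V t \<omega> / G_proc V s \<omega>) * y s \<omega>)" for s \<omega>
  have H[measurable]: "case_prod H \<in> borel_measurable (lborel \<Otimes>\<^sub>M M)"
    unfolding H_def G_proc_def by measurable
  have HH: "integrable M (\<lambda>\<omega>. H s \<omega> * H \<tau> \<omega>) \<and> expectation (\<lambda>\<omega>. H s \<omega> * H \<tau> \<omega>) =
      indicator {0..t} \<tau> * (indicator {0..t} s * (exp (2 * A t - A s - A \<tau> + t - max s \<tau>) * expectation (\<lambda>\<omega>. y s \<omega> * y \<tau> \<omega>)))" for s \<tau>
  proof (cases "s \<in> {0..t} \<and> \<tau> \<in> {0..t}")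
    case True
    let ?R = "\<lambda>\<omega>. exp (2 * A t - A s - A \<tau>) * (y s \<omega> * y \<tau> \<omega> * (ratio t s \<omega> * ratio t \<tau> \<omega>))"
    have yy: "integrable M (\<lambda>\<omega>. y s \<omega> * y \<tau> \<omega>)"
      by (rule Cauchy_Schwarz_integral) (auto intro: y2)
    note E = expectation_ratio_mult[of s \<tau> t, OF _ _ _ _ yy indep]
    have R: "integrable M ?R"
      by (rule integrable_mult_right, rule E(1)) (use True in auto)
    have ER: "expectation ?R = exp (2 * A t - A s - A \<tau>) * (exp (t - max s \<tau>) * expectation (\<lambda>\<omega>. y s \<omega> * y \<tau> \<omega>))"
      by (subst integral_mult_right_zero, subst E(2)) (use True in auto)
    have ER': "expectation ?R = exp (2 * A t - A s - A \<tau> + t - max s \<tau>) * expectation (\<lambda>\<omega>. y s \<omega> * y \<tau> \<omega>)"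
      unfolding ER by (simp only: mult.assoc[symmetric] exp_add[symmetric] add_diff_eq)
    have e: "exp (2 * A t - A s - A \<tau>) = exp (A t - A s) * exp (A t - A \<tau>)"
      by (simp add: exp_add[symmetric])
    \<comment> \<open>Independence is known for \<open>W\<close>, measurability of \<open>H\<close> for \<open>V\<close>; they meet almost surely.\<close>
    have ae: "AE \<omega> in M. H s \<omega> * H \<tau> \<omega> = ?R \<omega>"
      using VW by eventually_elim (use True in \<open>simp add: H_def G_proc_def e\<close>)
    have m: "(\<lambda>\<omega>. H s \<omega> * H \<tau> \<omega>) \<in> borel_measurable M" by measurable
    have "integrable M (\<lambda>\<omega>. H s \<omega> * H \<tau> \<omega>)"
      using integrable_cong_AE[OF m _ ae] R by (auto dest: borel_measurable_integrable)
    moreover have "expectation (\<lambda>\<omega>. H s \<omega> * H \<tau> \<omega>) = expectation ?R"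
      using R by (intro integral_cong_AE m ae) auto
    ultimately show ?thesis
      using True ER' by simp
  next
    case False
    then have "(\<lambda>\<omega>. H s \<omega> * H \<tau> \<omega>) = (\<lambda>\<omega>. 0)" by (auto simp: H_def)
    then show ?thesis using False by auto
  qed
  have "integrable lborel (\<lambda>s. sqrt (expectation (\<lambda>\<omega>. (H s \<omega>)\<^sup>2)))"
  proof (rule Bochner_Integration.integrable_bound)
    show "integrable lborel (\<lambda>s. exp (2 * B + t) * (indicator {0..t} s *\<^sub>R sqrt (expectation (\<lambda>\<omega>. (y s \<omega>)\<^sup>2))))"
      using nrm unfolding set_integrable_def by simp
    show "AE s in lborel. norm (sqrt (expectation (\<lambda>\<omega>. (H s \<omega>)\<^sup>2)))
       \<le> norm (exp (2 * B + t) * (indicator {0..t} s *\<^sub>R sqrt (expectation (\<lambda>\<omega>. (y s \<omega>)\<^sup>2))))"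
    proof (rule AE_I2)
      fix s :: real
      have "expectation (\<lambda>\<omega>. (H s \<omega>)\<^sup>2) = indicator {0..t} s * (exp (2 * A t - 2 * A s + (t - s)) * expectation (\<lambda>\<omega>. (y s \<omega>)\<^sup>2))"
        using HH[of s s] by (auto simp: power2_eq_square indicator_def algebra_simps)
      also have "\<dots> \<le> indicator {0..t} s * (exp (2 * (2 * B + t)) * expectation (\<lambda>\<omega>. (y s \<omega>)\<^sup>2))"
      proof (cases "s \<in> {0..t}")
        case True
        then have "exp (2 * A t - 2 * A s + (t - s)) \<le> exp (2 * (2 * B + t))"
          using AB[of s] AB[of t] by auto
        with True show ?thesis by (simp add: mult_right_mono)
      qed simp
      also have "\<dots> = (exp (2 * B + t) * (indicator {0..t} s *\<^sub>R sqrt (expectation (\<lambda>\<omega>. (y s \<omega>)\<^sup>2))))\<^sup>2"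
        using exp_double[of "2 * B + t"] by (auto simp: power_mult_distrib indicator_def)
      finally show "norm (sqrt (expectation (\<lambda>\<omega>. (H s \<omega>)\<^sup>2)))
       \<le> norm (exp (2 * B + t) * (indicator {0..t} s *\<^sub>R sqrt (expectation (\<lambda>\<omega>. (y s \<omega>)\<^sup>2))))"
        using real_sqrt_le_iff[of "expectation (\<lambda>\<omega>. (H s \<omega>)\<^sup>2)"]
        by (metis (no_types, lifting) Bochner_Integration.integral_nonneg real_norm_def real_sqrt_abs real_sqrt_ge_zero abs_of_nonneg zero_le_power2)
    qed
  qed measurable
  note sm = second_moment_of_integral[OF sigma_finite_lborel sigma_finite_measure_axioms H _ this]
  have sq: "integrable M (\<lambda>\<omega>. (H s \<omega>)\<^sup>2)" for s
    using HH[of s s] by (simp add: power2_eq_square)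
  have \<xi>: "\<xi> \<omega> = (LBINT s. H s \<omega>)" for \<omega>
    unfolding \<xi>_def set_lebesgue_integral_def
    by (subst integral_mult_right_zero[symmetric], intro Bochner_Integration.integral_cong)
      (auto simp: H_def exp_diff exp_minus field_simps)
  show "integrable M (\<lambda>\<omega>. (\<xi> \<omega>)\<^sup>2)"
    unfolding \<xi> by (rule sm(1)[OF sq])
  show "expectation (\<lambda>\<omega>. (\<xi> \<omega>)\<^sup>2) = (LBINT \<tau>:{0..t}. LBINT s:{0..t}.
        exp (2 * A t - A s - A \<tau> + t - max s \<tau>) * expectation (\<lambda>\<omega>. y s \<omega> * y \<tau> \<omega>))"
    unfolding \<xi> sm(2)[OF sq] using HH by (simp add: set_lebesgue_integral_def)
qed

end

section \<open>Integrability of the coefficients\<close>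

lemma continuous_on_A_int:
  assumes "a \<in> Linf_fun T"
  shows "continuous_on {0..T} (A_int a)"
proof -
  from assms obtain C where [measurable]: "a \<in> borel_measurable (lebesgue_on {0..T})"
    and C: "AE t in lebesgue_on {0..T}. \<bar>a t\<bar> \<le> C"
    unfolding Linf_fun_def by auto
  have "finite_measure (lebesgue_on {0..T})"
    by (intro finite_measure_lebesgue_on) auto
  then have "integrable (lebesgue_on {0..T}) a"
    using C by (intro finite_measure.integrable_const_bound) auto
  from indefinite_integral_continuous_real[OF this]
  show ?thesis
    unfolding A_int_def set_lebesgue_integral_def by (simp add: integral_restrict_space)
qed

text \<open>
  A cheap substitute for Jensen's inequality, the factor \<open>2\<close> being harmless here: after
  normalising \<open>E[|Z|\<^sup>p]\<close>, if nonzero, to \<open>1\<close> it is the pointwise bound \<open>x \<le> 1 + x powr (p / 2)\<close> for \<open>x = Z\<^sup>2\<close>.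
\<close>

lemma (in prob_space) second_moment_le_Lp:
  fixes Z :: "'a \<Rightarrow> real"
  assumes [measurable]: "Z \<in> borel_measurable M" and "p > 2"
    and Lp: "integrable M (\<lambda>\<omega>. \<bar>Z \<omega>\<bar> powr p)"
  shows "integrable M (\<lambda>\<omega>. (Z \<omega>)\<^sup>2)"
    and "expectation (\<lambda>\<omega>. (Z \<omega>)\<^sup>2) \<le> 2 * expectation (\<lambda>\<omega>. \<bar>Z \<omega>\<bar> powr p) powr (2 / p)"
proof -
  let ?Q = "expectation (\<lambda>\<omega>. \<bar>Z \<omega>\<bar> powr p)"
  have "integrable M (\<lambda>\<omega>. (Z \<omega>)\<^sup>2) \<and> expectation (\<lambda>\<omega>. (Z \<omega>)\<^sup>2) \<le> 2 * ?Q powr (2 / p)"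
  proof (cases "?Q = 0")
    case True
    then have "AE \<omega> in M. \<bar>Z \<omega>\<bar> powr p = 0"
      using integral_nonneg_eq_0_iff_AE[OF Lp] by simp
    then have ae: "AE \<omega> in M. (Z \<omega>)\<^sup>2 = 0" by simp
    then show ?thesis
      using integrable_cong_AE[OF _ _ ae] integral_cong_AE[OF _ _ ae] by simp
  next
    case False
    then have Q: "?Q > 0" using Bochner_Integration.integral_nonneg[of M "\<lambda>\<omega>. \<bar>Z \<omega>\<bar> powr p"] by (simp add: less_le)
    define c where "c = ?Q powr (2 / p)"
    have c: "c > 0" using Q by (simp add: c_def)
    have cQ: "c powr (p / 2) = ?Q" using \<open>p > 2\<close> Q by (simp add: c_def powr_powr)
    have le: "(Z \<omega>)\<^sup>2 \<le> c + c / ?Q * \<bar>Z \<omega>\<bar> powr p" for \<omega>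
    proof (cases "(Z \<omega>)\<^sup>2 \<le> c")
      case True
      have "0 \<le> c / ?Q * \<bar>Z \<omega>\<bar> powr p" using c Q by simp
      with True show ?thesis by linarith
    next
      case False
      then have 1: "1 \<le> (Z \<omega>)\<^sup>2 / c" using c by simp
      have "(Z \<omega>)\<^sup>2 / c = ((Z \<omega>)\<^sup>2 / c) powr 1" using 1 c by simp
      also have "\<dots> \<le> ((Z \<omega>)\<^sup>2 / c) powr (p / 2)"
        using 1 \<open>p > 2\<close> by (intro powr_mono) auto
      also have "\<dots> = ((Z \<omega>)\<^sup>2) powr (p / 2) / ?Q"
        using c by (simp add: powr_divide cQ)
      also have "((Z \<omega>)\<^sup>2) powr (p / 2) = \<bar>Z \<omega>\<bar> powr p"
      proof -
        have "Z \<omega> \<noteq> 0" using False c by auto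
        then have "(Z \<omega>)\<^sup>2 = \<bar>Z \<omega>\<bar> powr 2" by simp
        then show ?thesis by (simp only: powr_powr) simp
      qed
      finally have "(Z \<omega>)\<^sup>2 \<le> c * (\<bar>Z \<omega>\<bar> powr p / ?Q)"
        using c by (simp add: pos_divide_le_eq mult.commute)
      then show ?thesis using c by simp
    qed
    have int: "integrable M (\<lambda>\<omega>. c + c / ?Q * \<bar>Z \<omega>\<bar> powr p)" using Lp by simp
    have "integrable M (\<lambda>\<omega>. (Z \<omega>)\<^sup>2)"
      by (rule Bochner_Integration.integrable_bound[OF int]) (use le in \<open>auto intro!: AE_I2 order_trans[OF _ abs_ge_self]\<close>)
    moreover have "expectation (\<lambda>\<omega>. (Z \<omega>)\<^sup>2) \<le> expectation (\<lambda>\<omega>. c + c / ?Q * \<bar>Z \<omega>\<bar> powr p)"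
      by (rule integral_mono) (use calculation int le in auto)
    moreover have "expectation (\<lambda>\<omega>. c + c / ?Q * \<bar>Z \<omega>\<bar> powr p) = 2 * c"
      using Lp Q by (simp add: prob_space)
    ultimately show ?thesis by (simp add: c_def)
  qed
  then show "integrable M (\<lambda>\<omega>. (Z \<omega>)\<^sup>2)"
    and "expectation (\<lambda>\<omega>. (Z \<omega>)\<^sup>2) \<le> 2 * ?Q powr (2 / p)" by auto
qed

text \<open>
  Controls are only Lebesgue measurable, whereas Fubini's theorem is applied on products of Borel
  measures. As the cost sees a control only through integrals, a Borel version may replace it.
\<close>

lemma L1_fun_borel_version:
  assumes "u \<in> L1_fun T"
  obtains u' where "u' \<in> borel_measurable borel" "integrable lborel u'"
    "AE s in lborel. s \<in> {0..T} \<longrightarrow> u s = u' s"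
proof -
  have int: "integrable lebesgue (\<lambda>s. indicator {0..T} s * u s)"
    using assms by (simp add: L1_fun_def integrable_restrict_space)
  then obtain u' where u': "u' \<in> borel_measurable lborel" "AE s in lborel. indicator {0..T} s * u s = u' s"
    using completion_ex_borel_measurable_real[of "\<lambda>s. indicator {0..T} s * u s" lborel] by auto
  have "integrable lebesgue u'"
    using int integrable_cong_AE[OF borel_measurable_integrable[OF int] _ AE_completion[OF u'(2)]] u'(1)
    by (simp add: measurable_completion)
  then have "integrable lborel u'"
    using u'(1) by (simp add: integrable_completion)
  moreover have "AE s in lborel. s \<in> {0..T} \<longrightarrow> u s = u' s"
    using u'(2) by eventually_elim auto
  ultimately show ?thesis using u'(1) by (intro that) auto
qed

section \<open>The control problem with an independent source\<close>

locale independent_source = brownian_motion +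
  fixes z :: "real \<Rightarrow> 'a \<Rightarrow> real" and a :: "real \<Rightarrow> real" and T p :: real
  assumes T_pos: "T > 0" and a_Linf: "a \<in> Linf_fun T"
    and z_joint: "(\<lambda>(t, \<omega>). z t \<omega>) \<in> borel_measurable (restrict_space borel {0..T} \<Otimes>\<^sub>M M)"
    and p_gt_2: "p > 2"
    and z_Lp: "\<And>t. t \<in> {0..T} \<Longrightarrow> integrable M (\<lambda>\<omega>. \<bar>z t \<omega>\<bar> powr p)"
    and z_L2_Lp: "(\<integral>\<^sup>+t\<in>{0..T}.
        ennreal (expectation (\<lambda>\<omega>. \<bar>z t \<omega>\<bar> powr p) powr (2 / p)) \<partial>lebesgue) < \<infinity>"
    and z_indep_W: "indep_var
        (Pi\<^sub>M {0..T} (\<lambda>_. borel)) (\<lambda>\<omega>. \<lambda>t\<in>{0..T}. z t \<omega>)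
        (Pi\<^sub>M {0..} (\<lambda>_. borel)) (\<lambda>\<omega>. \<lambda>t\<in>{0..}. W t \<omega>)"
begin

text \<open>
  The data are given, and measurable, on \<open>[0, T]\<close> only. Composing them with the projection of the real line
  onto \<open>[0, T]\<close> extends them to all times while preserving continuity, measurability and bounds
  that are uniform in time.
\<close>

definition clamp_time :: "real \<Rightarrow> real" where "clamp_time t = max 0 (min T t)"

lemma clamp_time_simps [simp]: "t \<in> {0..T} \<Longrightarrow> clamp_time t = t" "clamp_time t \<in> {0..T}"
  using T_pos by (auto simp: clamp_time_def)

lemma clamp_time_measurable [measurable]: "clamp_time \<in> borel_measurable borel"
  unfolding clamp_time_def by measurable

definition A_ext :: "real \<Rightarrow> real" where "A_ext t = A_int a (clamp_time t)"
definition z_ext :: "real \<Rightarrow> 'a \<Rightarrow> real" where "z_ext t = z (clamp_time t)"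

lemma A_ext_eq: "t \<in> {0..T} \<Longrightarrow> A_ext t = A_int a t"
  by (simp add: A_ext_def)

lemma z_ext_eq: "t \<in> {0..T} \<Longrightarrow> z_ext t = z t"
  by (simp add: z_ext_def)

lemma A_ext_measurable [measurable]: "A_ext \<in> borel_measurable borel"
proof (rule borel_measurable_continuous_onI)
  have "continuous_on UNIV clamp_time"
    unfolding clamp_time_def by (intro continuous_intros)
  then show "continuous_on UNIV A_ext"
    unfolding A_ext_def
    by (rule continuous_on_compose2[OF continuous_on_A_int[OF a_Linf]]) (auto simp del: atLeastAtMost_iff)
qed

lemma A_ext_bounded: obtains B where "\<And>t. \<bar>A_ext t\<bar> \<le> B"
proof -
  have "compact (A_int a ` {0..T})"
    by (intro compact_continuous_image continuous_on_A_int a_Linf) auto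
  then obtain B where "\<And>x. x \<in> A_int a ` {0..T} \<Longrightarrow> norm x \<le> B"
    using compact_imp_bounded bounded_iff by metis
  then show ?thesis by (intro that[of B]) (auto simp: A_ext_def simp del: atLeastAtMost_iff)
qed

lemma z_ext_measurable [measurable]: "case_prod z_ext \<in> borel_measurable (borel \<Otimes>\<^sub>M M)"
proof -
  have "(\<lambda>x. (clamp_time (fst x), snd x)) \<in> borel \<Otimes>\<^sub>M M \<rightarrow>\<^sub>M restrict_space borel {0..T} \<Otimes>\<^sub>M M"
    by (intro measurable_Pair measurable_restrict_space2) (auto simp del: atLeastAtMost_iff)
  from measurable_compose[OF this z_joint] show ?thesis
    by (simp add: z_ext_def case_prod_unfold)
qed

lemma z_ext_measurable' [measurable]: "z_ext s \<in> borel_measurable M"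
  by measurable

lemma z_ext_square_integrable: "integrable M (\<lambda>\<omega>. (z_ext s \<omega>)\<^sup>2)"
  and z_ext_second_moment_le: "expectation (\<lambda>\<omega>. (z_ext s \<omega>)\<^sup>2)
    \<le> 2 * expectation (\<lambda>\<omega>. \<bar>z_ext s \<omega>\<bar> powr p) powr (2 / p)"
  using second_moment_le_Lp[OF z_ext_measurable'[of s] p_gt_2] z_Lp[OF clamp_time_simps(2)]
  by (auto simp: z_ext_def)

lemma z_ext_integrable: "integrable M (z_ext s)"
  by (rule square_integrable_imp_integrable) (auto intro: z_ext_square_integrable)

definition z_ext_mean :: "real \<Rightarrow> real" where "z_ext_mean s = expectation (z_ext s)"

lemma z_ext_mean_measurable [measurable]: "z_ext_mean \<in> borel_measurable borel"
  unfolding z_ext_mean_def by measurable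

definition z_ext_norm :: "real \<Rightarrow> real" where "z_ext_norm s = sqrt (expectation (\<lambda>\<omega>. (z_ext s \<omega>)\<^sup>2))"

lemma z_ext_norm_measurable [measurable]: "z_ext_norm \<in> borel_measurable borel"
  unfolding z_ext_norm_def by measurable

lemma z_ext_norm_nonneg: "0 \<le> z_ext_norm s"
  by (simp add: z_ext_norm_def)

text \<open>
  The estimate on which the integrability of the state and of the covariance kernel rests: the assumption bounds the integral
  of \<open>z_ext_norm\<^sup>2\<close>, and \<open>x \<le> 1 + x\<^sup>2\<close>.
\<close>

lemma z_ext_norm_integrable: "integrable lborel (\<lambda>s. indicator {0..T} s * z_ext_norm s)"
proof (rule Bochner_Integration.integrable_bound)
  let ?q = "\<lambda>s. ennreal (expectation (\<lambda>\<omega>. \<bar>z_ext s \<omega>\<bar> powr p) powr (2 / p)) * indicator {0..T} s"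
  have "(\<integral>\<^sup>+s. ennreal (indicator {0..T} s * (z_ext_norm s)\<^sup>2) \<partial>lborel) \<le> (\<integral>\<^sup>+s. 2 * ?q s \<partial>lborel)"
  proof (rule nn_integral_mono)
    fix s :: real
    have "ennreal ((z_ext_norm s)\<^sup>2) \<le> ennreal (2 * expectation (\<lambda>\<omega>. \<bar>z_ext s \<omega>\<bar> powr p) powr (2 / p))"
      using z_ext_second_moment_le[of s] by (intro ennreal_leI) (simp add: z_ext_norm_def)
    then show "ennreal (indicator {0..T} s * (z_ext_norm s)\<^sup>2) \<le> 2 * ?q s"
      by (auto simp: indicator_def ennreal_mult)
  qed
  also have "\<dots> = 2 * (\<integral>\<^sup>+s. ?q s \<partial>lborel)"
    by (rule nn_integral_cmult) measurable
  also have "(\<integral>\<^sup>+s. ?q s \<partial>lborel) = (\<integral>\<^sup>+s\<in>{0..T}. ennreal (expectation (\<lambda>\<omega>. \<bar>z s \<omega>\<bar> powr p) powr (2 / p)) \<partial>lebesgue)"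
    unfolding nn_integral_completion by (intro nn_integral_cong) (auto simp: indicator_def z_ext_eq)
  also have "2 * \<dots> < \<infinity>"
    using z_L2_Lp by (simp add: ennreal_mult_less_top)
  finally have "integrable lborel (\<lambda>s. indicator {0..T} s * (z_ext_norm s)\<^sup>2)"
    by (intro integrableI_bounded) auto
  then show "integrable lborel (\<lambda>s. indicator {0..T} s + indicator {0..T} s * (z_ext_norm s)\<^sup>2)"
    by (intro Bochner_Integration.integrable_add integrable_real_indicator) (auto simp: emeasure_lborel_Icc_eq)
  have "z_ext_norm s \<le> 1 + (z_ext_norm s)\<^sup>2" for s
    using sum_squares_bound[of "z_ext_norm s" 1] z_ext_norm_nonneg[of s] by simp
  then show "AE s in lborel. norm (indicator {0..T} s * z_ext_norm s)
      \<le> norm (indicator {0..T} s + indicator {0..T} s * (z_ext_norm s)\<^sup>2)"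
    by (intro AE_I2) (auto simp: indicator_def z_ext_norm_nonneg)
qed measurable

lemma abs_z_ext_mean_le: "\<bar>z_ext_mean s\<bar> \<le> z_ext_norm s"
proof -
  have "(z_ext_mean s)\<^sup>2 \<le> (z_ext_norm s)\<^sup>2"
    using variance_eq[OF z_ext_integrable z_ext_square_integrable, of s] variance_positive[of "z_ext s"]
    by (simp add: z_ext_norm_def z_ext_mean_def)
  then show ?thesis using z_ext_norm_nonneg by (simp add: abs_le_square_iff[symmetric])
qed

section \<open>Reduction of the cost to a deterministic double integral\<close>

definition kern :: "real \<Rightarrow> real \<Rightarrow> real \<Rightarrow> real" where
  "kern t \<tau> s = exp (2 * A_ext t - A_ext s - A_ext \<tau> + t - max s \<tau>)"

text \<open>
  The second moment \<open>E[\<xi>\<^sub>u(t)\<^sup>2]\<close> of the state, as shown in the proof of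
  \<open>J2_eq_state_moment\<close>.
\<close>

definition state_moment :: "(real \<Rightarrow> real) \<Rightarrow> real \<Rightarrow> real" where
  "state_moment u t = (LBINT \<tau>:{0..t}. LBINT s:{0..t}.
     kern t \<tau> s * expectation (\<lambda>\<omega>. (z_ext s \<omega> - u s) * (z_ext \<tau> \<omega> - u \<tau>)))"

lemma indep_products:
  assumes [simp]: "s \<in> {0..T}" "\<tau> \<in> {0..T}" "t \<in> {0..T}"
  shows "indep_var borel (\<lambda>\<omega>. (z_ext s \<omega> - c) * (z_ext \<tau> \<omega> - d)) borel (\<lambda>\<omega>. ratio t s \<omega> * ratio t \<tau> \<omega>)"
proof -
  let ?f = "\<lambda>x. (x s - c) * (x \<tau> - d)"
  let ?g = "\<lambda>x. (exp (x t - t / 2) / exp (x s - s / 2)) * (exp (x t - t / 2) / exp (x \<tau> - \<tau> / 2))"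
  have [measurable]: "(\<lambda>x. x r) \<in> borel_measurable (Pi\<^sub>M {0..T} (\<lambda>_. borel :: real measure))" if "r \<in> {0..T}" for r
    using that by (rule measurable_component_singleton)
  have [measurable]: "(\<lambda>x. x r) \<in> borel_measurable (Pi\<^sub>M {0..} (\<lambda>_. borel :: real measure))" if "r \<in> {0..T}" for r
    using that by (intro measurable_component_singleton) auto
  have "indep_var borel (?f \<circ> (\<lambda>\<omega>. \<lambda>t\<in>{0..T}. z t \<omega>)) borel (?g \<circ> (\<lambda>\<omega>. \<lambda>t\<in>{0..}. W t \<omega>))"
    by (rule indep_var_compose[OF z_indep_W]) (use assms in measurable)
  moreover have "?f \<circ> (\<lambda>\<omega>. \<lambda>t\<in>{0..T}. z t \<omega>) = (\<lambda>\<omega>. (z_ext s \<omega> - c) * (z_ext \<tau> \<omega> - d))"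
    using assms by (auto simp: z_ext_def)
  moreover have "?g \<circ> (\<lambda>\<omega>. \<lambda>t\<in>{0..}. W t \<omega>) = (\<lambda>\<omega>. ratio t s \<omega> * ratio t \<tau> \<omega>)"
    using assms by (auto simp: G_proc_def)
  ultimately show ?thesis by simp
qed

lemma deviation_square_integrable: "integrable M (\<lambda>\<omega>. (z_ext s \<omega> - c)\<^sup>2)"
  using z_ext_integrable[of s] z_ext_square_integrable[of s]
  by (simp add: power2_diff)

lemma deviation_norm_integrable:
  assumes [measurable]: "u \<in> borel_measurable borel" and u: "set_integrable lborel {0..T} u"
  shows "set_integrable lborel {0..T} (\<lambda>s. sqrt (expectation (\<lambda>\<omega>. (z_ext s \<omega> - u s)\<^sup>2)))"
  unfolding set_integrable_def
proof (rule Bochner_Integration.integrable_bound)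
  show "integrable lborel (\<lambda>s. 2 * (indicator {0..T} s * z_ext_norm s) + 2 * \<bar>indicator {0..T} s * u s\<bar>)"
    using z_ext_norm_integrable u by (auto simp: set_integrable_def)
  have "sqrt (expectation (\<lambda>\<omega>. (z_ext s \<omega> - u s)\<^sup>2)) \<le> 2 * z_ext_norm s + 2 * \<bar>u s\<bar>" for s
  proof (rule real_le_lsqrt)
    have "(x - y)\<^sup>2 \<le> 2 * x\<^sup>2 + 2 * y\<^sup>2" for x y :: real
      using zero_le_power2[of "x + y"] by (simp add: power2_sum power2_diff)
    then have "expectation (\<lambda>\<omega>. (z_ext s \<omega> - u s)\<^sup>2) \<le> expectation (\<lambda>\<omega>. 2 * (z_ext s \<omega>)\<^sup>2 + 2 * (u s)\<^sup>2)"
      using deviation_square_integrable z_ext_square_integrable[of s] by (intro integral_mono) auto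
    also have "\<dots> = 2 * (z_ext_norm s)\<^sup>2 + 2 * \<bar>u s\<bar>\<^sup>2"
      using z_ext_square_integrable[of s] by (simp add: prob_space z_ext_norm_def)
    also have "\<dots> \<le> (2 * z_ext_norm s + 2 * \<bar>u s\<bar>)\<^sup>2"
      using z_ext_norm_nonneg[of s] by (simp add: power2_sum power_mult_distrib)
    finally show "expectation (\<lambda>\<omega>. (z_ext s \<omega> - u s)\<^sup>2) \<le> (2 * z_ext_norm s + 2 * \<bar>u s\<bar>)\<^sup>2" .
  qed (simp add: z_ext_norm_nonneg)
  then show "AE s in lborel. norm (indicator {0..T} s *\<^sub>R sqrt (expectation (\<lambda>\<omega>. (z_ext s \<omega> - u s)\<^sup>2)))
      \<le> norm (2 * (indicator {0..T} s * z_ext_norm s) + 2 * \<bar>indicator {0..T} s * u s\<bar>)"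
    by (intro AE_I2) (auto simp: indicator_def z_ext_norm_nonneg)
qed measurable

text \<open>
  The control \<open>u\<close> enters \<^const>\<open>J2\<close>, its Borel version \<open>u'\<close> the deterministic formula; allowing the two to
  differ on a null set covers all representatives of a class in \<open>L\<^sup>1(0, T)\<close>. The nonnegativity is not visible
  from the formula: it holds because the quantity is the expectation of a square.
\<close>

lemma J2_eq_state_moment:
  assumes [measurable]: "u' \<in> borel_measurable borel" and u'_int: "set_integrable lborel {0..T} u'"
    and u_meas: "(\<lambda>s. indicator {0..T} s * u s) \<in> borel_measurable lebesgue"
    and uu': "AE s in lborel. s \<in> {0..T} \<longrightarrow> u s = u' s"
  shows "J2 M T a W z u = (\<integral>\<^sup>+t\<in>{0..T}. ennreal (state_moment u' t / 2) \<partial>lborel)"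
    and "t \<in> {0..T} \<Longrightarrow> 0 \<le> state_moment u' t"
proof -
  obtain V where V[measurable]: "case_prod V \<in> borel_measurable (borel \<Otimes>\<^sub>M M)"
    and VW: "AE \<omega> in M. \<forall>t\<ge>0. V t \<omega> = W t \<omega>"
    using continuous_modification by blast
  obtain B where B: "\<And>t. \<bar>A_ext t\<bar> \<le> B" using A_ext_bounded by blast
  let ?y = "\<lambda>s \<omega>. z_ext s \<omega> - u' s"
  define \<xi> where "\<xi> t \<omega> = G_proc V t \<omega> * exp (A_ext t) * (LBINT s:{0..t}. exp (- A_ext s) / G_proc V s \<omega> * ?y s \<omega>)" for t \<omega>
  have moment: "integrable M (\<lambda>\<omega>. (\<xi> t \<omega>)\<^sup>2)" "expectation (\<lambda>\<omega>. (\<xi> t \<omega>)\<^sup>2) = state_moment u' t"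
    if "t \<in> {0..T}" for t
  proof -
    have nrm: "set_integrable lborel {0..t} (\<lambda>s. sqrt (expectation (\<lambda>\<omega>. (?y s \<omega>)\<^sup>2)))"
      using that by (intro set_integrable_subset[OF deviation_norm_integrable[OF assms(1,2)]]) auto
    have y: "case_prod ?y \<in> borel_measurable (borel \<Otimes>\<^sub>M M)" by measurable
    have ind: "indep_var borel (\<lambda>\<omega>. ?y s \<omega> * ?y \<tau> \<omega>) borel (\<lambda>\<omega>. ratio t s \<omega> * ratio t \<tau> \<omega>)"
      if "s \<in> {0..t}" "\<tau> \<in> {0..t}" for s \<tau>
      using that \<open>t \<in> {0..T}\<close> by (intro indep_products) auto
    have "0 \<le> t" using that by simp
    note second_moment_of_state[OF V VW A_ext_measurable B y deviation_square_integrable nrm ind this]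
    then show "integrable M (\<lambda>\<omega>. (\<xi> t \<omega>)\<^sup>2)" "expectation (\<lambda>\<omega>. (\<xi> t \<omega>)\<^sup>2) = state_moment u' t"
      by (simp_all add: \<xi>_def state_moment_def kern_def)
  qed
  show "0 \<le> state_moment u' t" if "t \<in> {0..T}"
    unfolding moment(2)[OF that, symmetric] by simp
  \<comment> \<open>Almost surely, the state computed from \<open>W\<close>, \<open>u\<close> and Lebesgue integrals is the one computed from the Borel data.\<close>
  have \<xi>_eq: "AE \<omega> in M. \<forall>t\<in>{0..T}. xi_proc a W z u t \<omega> = \<xi> t \<omega>"
    using VW AE_space
  proof eventually_elim
    case (elim \<omega>)
    then have [measurable]: "(\<lambda>s. V s \<omega>) \<in> borel_measurable borel" "(\<lambda>s. z_ext s \<omega>) \<in> borel_measurable borel"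
      by measurable
    have G: "G_proc W s \<omega> = G_proc V s \<omega>" if "0 \<le> s" for s
      using elim that by (simp add: G_proc_def)
    have [measurable]: "(\<lambda>s. G_proc V s \<omega>) \<in> borel_measurable borel"
      unfolding G_proc_def by measurable
    show ?case
    proof
      fix t assume t: "t \<in> {0..T}"
      let ?c = "\<lambda>s. indicator {0..t} s * (exp (- A_ext s) / G_proc V s \<omega>)"
      have "(LINT s:{0..t}|lebesgue. exp (- A_int a s) / G_proc W s \<omega> * (z s \<omega> - u s))
        = (LINT s|lebesgue. ?c s * (z_ext s \<omega> - indicator {0..T} s * u s))"
        unfolding set_lebesgue_integral_def
        by (rule Bochner_Integration.integral_cong)
          (use t in \<open>auto simp: indicator_def G A_ext_eq z_ext_eq\<close>)
      also have "\<dots> = (LINT s|lebesgue. ?c s * (z_ext s \<omega> - u' s))"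
      proof (rule integral_cong_AE)
        show "(\<lambda>s. ?c s * (z_ext s \<omega> - indicator {0..T} s * u s)) \<in> borel_measurable lebesgue"
          by (intro borel_measurable_times borel_measurable_diff u_meas measurable_completion) measurable
        show "(\<lambda>s. ?c s * (z_ext s \<omega> - u' s)) \<in> borel_measurable lebesgue"
          by (intro measurable_completion) measurable
        show "AE s in lebesgue. ?c s * (z_ext s \<omega> - indicator {0..T} s * u s) = ?c s * (z_ext s \<omega> - u' s)"
          using AE_completion[OF uu'] by eventually_elim (use t in \<open>auto simp: indicator_def\<close>)
      qed
      also have "\<dots> = (LBINT s. ?c s * (z_ext s \<omega> - u' s))"
        by (rule integral_completion) measurable
      also have "\<dots> = (LBINT s:{0..t}. exp (- A_ext s) / G_proc V s \<omega> * ?y s \<omega>)"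
        unfolding set_lebesgue_integral_def by (simp add: mult.assoc)
      finally show "xi_proc a W z u t \<omega> = \<xi> t \<omega>"
        unfolding xi_proc_def \<xi>_def using t G[of t] by (simp add: A_ext_eq)
    qed
  qed
  interpret LM: pair_sigma_finite lborel M ..
  have [measurable]: "case_prod \<xi> \<in> borel_measurable (lborel \<Otimes>\<^sub>M M)"
  proof -
    have "\<xi> = (\<lambda>t \<omega>. G_proc V t \<omega> * exp (A_ext t) * (LBINT s. (if 0 \<le> s \<and> s \<le> t then exp (- A_ext s) / G_proc V s \<omega> * ?y s \<omega> else 0)))"
      unfolding \<xi>_def set_lebesgue_integral_def
      by (intro ext arg_cong2[where f="(*)"] refl Bochner_Integration.integral_cong) (auto simp: indicator_def)
    then show ?thesis unfolding G_proc_def by simp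
  qed
  have "J2 M T a W z u = (\<integral>\<^sup>+\<omega>. (\<integral>\<^sup>+t\<in>{0..T}. ennreal ((\<xi> t \<omega>)\<^sup>2 / 2) \<partial>lborel) \<partial>M)"
    unfolding J2_def nn_integral_completion
    by (intro nn_integral_cong_AE eventually_mono[OF \<xi>_eq] nn_integral_cong) (auto simp: indicator_def)
  also have "\<dots> = (\<integral>\<^sup>+t. (\<integral>\<^sup>+\<omega>. ennreal ((\<xi> t \<omega>)\<^sup>2 / 2) * indicator {0..T} t \<partial>M) \<partial>lborel)"
    by (rule LM.Fubini') measurable
  also have "\<dots> = (\<integral>\<^sup>+t\<in>{0..T}. ennreal (state_moment u' t / 2) \<partial>lborel)"
  proof (rule nn_integral_cong)
    fix t :: real
    show "(\<integral>\<^sup>+\<omega>. ennreal ((\<xi> t \<omega>)\<^sup>2 / 2) * indicator {0..T} t \<partial>M) = ennreal (state_moment u' t / 2) * indicator {0..T} t"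
    proof (cases "t \<in> {0..T}")
      case True
      have "(\<integral>\<^sup>+\<omega>. ennreal ((\<xi> t \<omega>)\<^sup>2 / 2) \<partial>M) = ennreal (expectation (\<lambda>\<omega>. (\<xi> t \<omega>)\<^sup>2 / 2))"
        using moment(1)[OF True] by (intro nn_integral_eq_integral) auto
      then show ?thesis using True moment(2)[OF True] by simp
    qed simp
  qed
  finally show "J2 M T a W z u = (\<integral>\<^sup>+t\<in>{0..T}. ennreal (state_moment u' t / 2) \<partial>lborel)" .
qed

section \<open>Splitting off the excess cost of a control\<close>

definition z_ext_cov :: "real \<Rightarrow> real \<Rightarrow> real" where
  "z_ext_cov s \<tau> = expectation (\<lambda>\<omega>. (z_ext s \<omega> - z_ext_mean s) * (z_ext \<tau> \<omega> - z_ext_mean \<tau>))"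

lemma deviation_product_integrable: "integrable M (\<lambda>\<omega>. (z_ext s \<omega> - c) * (z_ext \<tau> \<omega> - d))"
  by (rule Cauchy_Schwarz_integral) (auto intro: deviation_square_integrable)

lemma z_ext_cov_measurable [measurable]: "(\<lambda>x. z_ext_cov (snd x) (fst x)) \<in> borel_measurable (lborel \<Otimes>\<^sub>M lborel)"
  unfolding z_ext_cov_def by measurable

lemma abs_z_ext_cov_le: "\<bar>z_ext_cov s \<tau>\<bar> \<le> z_ext_norm s * z_ext_norm \<tau>"
proof -
  have le: "sqrt (expectation (\<lambda>\<omega>. (z_ext s \<omega> - z_ext_mean s)\<^sup>2)) \<le> z_ext_norm s" for s
    using variance_eq[OF z_ext_integrable z_ext_square_integrable, of s]
    by (simp add: z_ext_norm_def z_ext_mean_def)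
  have "\<bar>z_ext_cov s \<tau>\<bar> \<le> expectation (\<lambda>\<omega>. \<bar>(z_ext s \<omega> - z_ext_mean s) * (z_ext \<tau> \<omega> - z_ext_mean \<tau>)\<bar>)"
    unfolding z_ext_cov_def by (rule integral_abs_bound)
  also have "\<dots> \<le> sqrt (expectation (\<lambda>\<omega>. (z_ext s \<omega> - z_ext_mean s)\<^sup>2)) * sqrt (expectation (\<lambda>\<omega>. (z_ext \<tau> \<omega> - z_ext_mean \<tau>)\<^sup>2))"
    by (rule Cauchy_Schwarz_integral) (auto intro: deviation_square_integrable)
  also have "\<dots> \<le> z_ext_norm s * z_ext_norm \<tau>"
    by (intro mult_mono le) (auto simp: z_ext_norm_nonneg)
  finally show ?thesis .
qed

lemma expectation_deviation_product:
  "expectation (\<lambda>\<omega>. (z_ext s \<omega> - u) * (z_ext \<tau> \<omega> - v)) = z_ext_cov s \<tau> + (z_ext_mean s - u) * (z_ext_mean \<tau> - v)"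
proof -
  have "(z_ext s \<omega> - u) * (z_ext \<tau> \<omega> - v) = (z_ext s \<omega> - z_ext_mean s) * (z_ext \<tau> \<omega> - z_ext_mean \<tau>) +
      ((z_ext_mean s - u) * (z_ext \<tau> \<omega> - z_ext_mean \<tau>) + (z_ext_mean \<tau> - v) * (z_ext s \<omega> - z_ext_mean s) + (z_ext_mean s - u) * (z_ext_mean \<tau> - v))" for \<omega>
    by (simp add: algebra_simps)
  then show ?thesis
    using deviation_product_integrable[of s "z_ext_mean s" \<tau> "z_ext_mean \<tau>"] z_ext_integrable[of s] z_ext_integrable[of \<tau>]
    by (simp add: prob_space z_ext_cov_def z_ext_mean_def)
qed

lemma kern_bounded: obtains C where "C \<ge> 0" "\<And>t \<tau> s. t \<in> {0..T} \<Longrightarrow> \<tau> \<in> {0..t} \<Longrightarrow> s \<in> {0..t} \<Longrightarrow> \<bar>kern t \<tau> s\<bar> \<le> C"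
proof -
  obtain B where B: "\<And>t. \<bar>A_ext t\<bar> \<le> B" using A_ext_bounded by blast
  have "\<bar>kern t \<tau> s\<bar> \<le> exp (4 * B + T)" if "t \<in> {0..T}" "\<tau> \<in> {0..t}" "s \<in> {0..t}" for t \<tau> s
  proof -
    have "0 \<le> max s \<tau>" using that by auto
    then have "2 * A_ext t - A_ext s - A_ext \<tau> + t - max s \<tau> \<le> 4 * B + T"
      using B[of t] B[of s] B[of \<tau>] that unfolding atLeastAtMost_iff by linarith
    then show ?thesis by (simp add: kern_def)
  qed
  then show ?thesis by (intro that[of "exp (4 * B + T)"]) auto
qed

lemma z_ext_mean_integrable: "set_integrable lborel {0..T} z_ext_mean"
  unfolding set_integrable_def
  by (rule Bochner_Integration.integrable_bound[OF z_ext_norm_integrable])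
    (auto simp: indicator_def intro!: AE_I2 order_trans[OF abs_z_ext_mean_le])

lemma state_moment_z_ext_mean:
  "state_moment z_ext_mean t = (LBINT \<tau>:{0..t}. LBINT s:{0..t}. kern t \<tau> s * z_ext_cov s \<tau>)"
  by (simp add: state_moment_def z_ext_cov_def)

definition weighted_error :: "(real \<Rightarrow> real) \<Rightarrow> real \<Rightarrow> real" where
  "weighted_error u s = indicator {0..T} s * (exp (- A_ext s) * (z_ext_mean s - u s))"

lemma weighted_error_integrable:
  assumes [measurable]: "u \<in> borel_measurable borel" and "set_integrable lborel {0..T} u"
  shows "integrable lborel (weighted_error u)"
proof -
  obtain B where B: "\<And>t. \<bar>A_ext t\<bar> \<le> B" using A_ext_bounded by blast
  show ?thesis
  proof (rule Bochner_Integration.integrable_bound)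
    show "integrable lborel (\<lambda>s. exp B * (indicator {0..T} s * z_ext_mean s - indicator {0..T} s * u s))"
      using assms(2) z_ext_mean_integrable by (simp add: set_integrable_def)
    have "exp (- A_ext s) \<le> exp B" for s using B[of s] by auto
    then show "AE s in lborel. norm (weighted_error u s) \<le> norm (exp B * (indicator {0..T} s * z_ext_mean s - indicator {0..T} s * u s))"
      by (intro AE_I2) (auto simp: weighted_error_def abs_mult indicator_def intro!: mult_right_mono)
    show "weighted_error u \<in> borel_measurable lborel"
      unfolding weighted_error_def by measurable
  qed
qed

text \<open>
  The contribution \<open>\<integral>\<integral> k v(s) v(\<tau>)\<close> of the error \<open>v = E z - u\<close> to \<open>E[\<xi>\<^sub>u(t)\<^sup>2]\<close>, written as a sum
  of squares by \<open>exp_max_quadratic_form\<close>.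
\<close>

definition excess :: "(real \<Rightarrow> real) \<Rightarrow> real \<Rightarrow> real" where
  "excess u t = exp (2 * A_ext t) * ((LBINT s:{0..t}. weighted_error u s)\<^sup>2
     + (LBINT r:{0..t}. exp (t - r) * (LBINT s:{0..r}. weighted_error u s)\<^sup>2))"

text \<open>
  The mixed terms vanish because \<open>z - E z\<close> is centred, so the second moment splits into the covariance part, which
  is the moment for the control \<open>E z\<close>, and the excess.
\<close>

lemma state_moment_decomposition:
  assumes [measurable]: "u \<in> borel_measurable borel" and u: "set_integrable lborel {0..T} u"
    and t: "t \<in> {0..T}"
  shows "state_moment u t = state_moment z_ext_mean t + excess u t"
proof -
  obtain C where C: "C \<ge> 0" "\<And>t \<tau> s. t \<in> {0..T} \<Longrightarrow> \<tau> \<in> {0..t} \<Longrightarrow> s \<in> {0..t} \<Longrightarrow> \<bar>kern t \<tau> s\<bar> \<le> C"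
    using kern_bounded by blast
  obtain B where B: "\<And>t. \<bar>A_ext t\<bar> \<le> B" using A_ext_bounded by blast
  let ?I = "\<lambda>x. indicator {0..t} (fst x) * indicator {0..t} (snd x) :: real"
  let ?v = "\<lambda>s. z_ext_mean s - u s"
  let ?f = "\<lambda>x. ?I x * (kern t (fst x) (snd x) * z_ext_cov (snd x) (fst x))"
  let ?g = "\<lambda>x. ?I x * (kern t (fst x) (snd x) * (?v (snd x) * ?v (fst x)))"
  have f: "integrable (lborel \<Otimes>\<^sub>M lborel) ?f"
  proof (rule integrable_dominated_by_product[OF _ z_ext_norm_integrable])
    show "?f \<in> borel_measurable (lborel \<Otimes>\<^sub>M lborel)" unfolding kern_def by measurable
    show "\<bar>?f (\<tau>, s)\<bar> \<le> C * ((indicator {0..T} \<tau> * z_ext_norm \<tau>) * (indicator {0..T} s * z_ext_norm s))" for \<tau> s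
      using t C(1) mult_mono[OF C(2)[OF t] abs_z_ext_cov_le[of s \<tau>], of \<tau> s]
      by (auto simp: indicator_def abs_mult z_ext_norm_nonneg mult.commute)
  qed
  have g: "integrable (lborel \<Otimes>\<^sub>M lborel) ?g"
  proof (rule integrable_dominated_by_product)
    show "?g \<in> borel_measurable (lborel \<Otimes>\<^sub>M lborel)" unfolding kern_def by measurable
    show "integrable lborel (\<lambda>s. \<bar>indicator {0..T} s * z_ext_mean s - indicator {0..T} s * u s\<bar>)"
      using u z_ext_mean_integrable by (simp add: set_integrable_def)
    show "\<bar>?g (\<tau>, s)\<bar> \<le> C * (\<bar>indicator {0..T} \<tau> * z_ext_mean \<tau> - indicator {0..T} \<tau> * u \<tau>\<bar> * \<bar>indicator {0..T} s * z_ext_mean s - indicator {0..T} s * u s\<bar>)" for \<tau> s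
      using t C(1) mult_right_mono[OF C(2)[OF t], of \<tau> s "\<bar>?v s\<bar> * \<bar>?v \<tau>\<bar>"]
      by (auto simp: indicator_def abs_mult mult.commute)
  qed
  have "state_moment u t = (LBINT \<tau>. LBINT s. ?f (\<tau>, s) + ?g (\<tau>, s))"
    unfolding state_moment_def set_lebesgue_integral_def expectation_deviation_product
      integral_scaleR_right[symmetric]
    by (intro Bochner_Integration.integral_cong) (auto simp: algebra_simps)
  also have "\<dots> = (LBINT \<tau>. LBINT s. ?f (\<tau>, s)) + (LBINT \<tau>. LBINT s. ?g (\<tau>, s))"
    by (rule double_integral_add[OF f g])
  also have "(LBINT \<tau>. LBINT s. ?f (\<tau>, s)) = state_moment z_ext_mean t"
    unfolding state_moment_z_ext_mean set_lebesgue_integral_def integral_scaleR_right[symmetric]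
    by (intro Bochner_Integration.integral_cong) auto
  also have "(LBINT \<tau>. LBINT s. ?g (\<tau>, s)) = exp (2 * A_ext t) *
      (LBINT \<tau>:{0..t}. LBINT s:{0..t}. exp (t - max s \<tau>) * (weighted_error u s * weighted_error u \<tau>))"
    unfolding set_lebesgue_integral_def integral_scaleR_right[symmetric] integral_mult_right_zero[symmetric]
    by (intro Bochner_Integration.integral_cong refl)
      (use t in \<open>auto simp: weighted_error_def indicator_def kern_def exp_add exp_diff exp_minus field_simps\<close>)
  also have "\<dots> = excess u t"
    unfolding excess_def using weighted_error_integrable[OF assms(1,2)] by (subst exp_max_quadratic_form) auto
  finally show ?thesis .
qed

lemma excess_ge: "exp (2 * A_ext t) * (LBINT s:{0..t}. weighted_error u s)\<^sup>2 \<le> excess u t"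
  unfolding excess_def set_lebesgue_integral_def[of _ "{0..t}" "\<lambda>r. exp (t - r) * _ r"]
  by (intro mult_left_mono) (auto intro!: Bochner_Integration.integral_nonneg)

lemma excess_nonneg: "0 \<le> excess u t"
  by (rule order_trans[OF _ excess_ge]) auto

lemma excess_measurable [measurable]:
  assumes [measurable]: "u \<in> borel_measurable borel"
  shows "excess u \<in> borel_measurable borel"
proof -
  have [measurable]: "weighted_error u \<in> borel_measurable borel"
    unfolding weighted_error_def by measurable
  have p: "(LBINT s:{0..r}. weighted_error u s) = (LBINT s. if 0 \<le> s \<and> s \<le> r then weighted_error u s else 0)" for r
    unfolding set_lebesgue_integral_def by (intro Bochner_Integration.integral_cong) (auto simp: indicator_def)
  have q: "(LBINT r:{0..t}. exp (t - r) * f r) = (LBINT r. if 0 \<le> r \<and> r \<le> t then exp (t - r) * f r else 0)" for t and f :: "real \<Rightarrow> real"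
    unfolding set_lebesgue_integral_def by (intro Bochner_Integration.integral_cong) (auto simp: indicator_def)
  show ?thesis unfolding excess_def q p by measurable
qed

lemma state_moment_z_ext_mean_measurable [measurable]: "state_moment z_ext_mean \<in> borel_measurable borel"
proof -
  have q: "(LBINT r:{0..t}. f r) = (LBINT r. if 0 \<le> r \<and> r \<le> t then f r else 0)" for t and f :: "real \<Rightarrow> real"
    unfolding set_lebesgue_integral_def by (intro Bochner_Integration.integral_cong) (auto simp: indicator_def)
  have "state_moment z_ext_mean = (\<lambda>t. LBINT \<tau>:{0..t}. LBINT s:{0..t}. kern t \<tau> s * z_ext_cov s \<tau>)"
    by (rule ext) (rule state_moment_z_ext_mean)
  then show ?thesis unfolding q kern_def z_ext_cov_def by simp
qed

text \<open>
  The first square alone forces the integral of the weighted error over \<open>[0, t]\<close> to vanish for almost every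
  \<open>t\<close>, hence for every \<open>t\<close> by continuity. The weighted error is therefore zero almost everywhere, and its weight
  \<open>exp (- A_ext s)\<close> never vanishes.
\<close>

lemma excess_AE_zero_imp:
  assumes [measurable]: "u \<in> borel_measurable borel" and u: "set_integrable lborel {0..T} u"
    and zero: "AE t in lborel. t \<in> {0..T} \<longrightarrow> excess u t = 0"
  shows "AE s in lborel. s \<in> {0..T} \<longrightarrow> u s = z_ext_mean s"
proof -
  let ?w = "weighted_error u"
  have w: "integrable lborel ?w" by (rule weighted_error_integrable[OF assms(1,2)])
  have wT: "integrable (lebesgue_on {0..T}) ?w"
  proof -
    have "(\<lambda>s. indicator {0..T} s *\<^sub>R ?w s) = ?w"
      by (auto simp: fun_eq_iff weighted_error_def indicator_def)
    then show ?thesis using w by (simp add: integrable_restrict_space integrable_completion)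
  qed
  have "continuous_on {0..T} (\<lambda>t. integral\<^sup>L (lebesgue_on {0..t}) ?w)"
    by (rule indefinite_integral_continuous_real[OF wT])
  moreover have "integral\<^sup>L (lebesgue_on {0..t}) ?w = (LBINT s:{0..t}. ?w s)" for t
    using w by (simp add: integral_restrict_space set_lebesgue_integral_def integral_completion)
  ultimately have cont: "continuous_on {0..T} (\<lambda>t. LBINT s:{0..t}. ?w s)" by simp
  have ae: "AE t in lborel. t \<in> {0..T} \<longrightarrow> (LBINT s:{0..t}. ?w s) = 0"
    using zero
  proof eventually_elim
    case (elim t)
    have "(LBINT s:{0..t}. ?w s) = 0" if "excess u t = 0"
    proof -
      have "exp (2 * A_ext t) * (LBINT s:{0..t}. ?w s)\<^sup>2 \<le> 0" using excess_ge[of t u] that by simp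
      then have "(LBINT s:{0..t}. ?w s)\<^sup>2 \<le> 0" by (simp add: mult_le_0_iff)
      then show ?thesis by simp
    qed
    with elim show ?case by simp
  qed
  have z: "(LBINT s:{0..t}. ?w s) = 0" if "t \<in> {0..T}" for t
    using continuous_AE_zero[OF cont T_pos ae that] .
  have out: "?w s = 0" if "s \<notin> {0..T}" for s using that by (simp add: weighted_error_def)
  have "AE s in lborel. ?w s = 0"
  proof (rule AE_zero_if_integrals_zero[OF w])
    fix t :: real
    have "(LBINT s:{t<..}. ?w s) = (LBINT s:{0..T}. ?w s) - (LBINT s:{0..min T t}. ?w s)"
    proof -
      have si: "set_integrable lborel A ?w" if "A \<in> sets borel" for A
        unfolding set_integrable_def using w that by (intro integrable_mult_indicator) auto
      have "(LBINT s:{t<..}. ?w s) = (LBINT s. indicator {0..T} s *\<^sub>R ?w s - indicator {0..min T t} s *\<^sub>R ?w s)"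
        unfolding set_lebesgue_integral_def
        by (intro Bochner_Integration.integral_cong) (use out in \<open>auto simp: indicator_def\<close>)
      then show ?thesis
        using si[of "{0..T}"] si[of "{0..min T t}"] by (simp add: set_lebesgue_integral_def set_integrable_def)
    qed
    also have "\<dots> = 0"
    proof (cases "t < 0")
      case True
      then show ?thesis using z[of T] T_pos by (simp add: set_lebesgue_integral_def)
    next
      case False
      then show ?thesis using z[of T] z[of "min T t"] T_pos by simp
    qed
    finally show "(LBINT s:{t<..}. ?w s) = 0" .
  qed
  then show ?thesis by eventually_elim (auto simp: weighted_error_def)
qed

section \<open>The minimizer and the minimal value\<close>

text \<open>
  On the domain of integration the kernel is bounded and the absolute covariance is at most \<open>z_ext_norm s * z_ext_norm \<tau>\<close>.
\<close>

lemma kern_cov_integrable: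
  "integrable (lborel \<Otimes>\<^sub>M (lborel \<Otimes>\<^sub>M lborel)) (\<lambda>x. indicator {(t, \<tau>, s). 0 \<le> t \<and> t \<le> T \<and> 0 \<le> \<tau> \<and> \<tau> \<le> t \<and> 0 \<le> s \<and> s \<le> t} x
    * (kern (fst x) (fst (snd x)) (snd (snd x)) * z_ext_cov (snd (snd x)) (fst (snd x))))"
  (is "integrable _ (\<lambda>x. indicator ?D x * ?f x)")
proof -
  obtain C where C: "C \<ge> 0" "\<And>t \<tau> s. t \<in> {0..T} \<Longrightarrow> \<tau> \<in> {0..t} \<Longrightarrow> s \<in> {0..t} \<Longrightarrow> \<bar>kern t \<tau> s\<bar> \<le> C"
    using kern_bounded by blast
  interpret L3: pair_sigma_finite lborel "lborel \<Otimes>\<^sub>M lborel :: (real \<times> real) measure" ..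
  let ?n = "\<lambda>s. indicator {0..T} s * z_ext_norm s"
  have [measurable]: "?n \<in> borel_measurable borel" by measurable
  show ?thesis
  proof (rule Bochner_Integration.integrable_bound)
    have nn: "integrable (lborel \<Otimes>\<^sub>M lborel) (\<lambda>x. ?n (fst x) * ?n (snd x))"
      by (rule integrable_dominated_by_product[where C=1, OF _ z_ext_norm_integrable])
        (measurable, simp add: z_ext_norm_nonneg)
    have iT: "integrable lborel (indicat_real {0..T})"
      by (intro integrable_real_indicator) (auto simp: emeasure_lborel_Icc_eq)
    show "integrable (lborel \<Otimes>\<^sub>M (lborel \<Otimes>\<^sub>M lborel)) (\<lambda>x. C * (indicator {0..T} (fst x) * (?n (fst (snd x)) * ?n (snd (snd x)))))"
    proof (rule L3.Fubini_integrable)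
      show "integrable lborel (\<lambda>t. LINT x|(lborel \<Otimes>\<^sub>M lborel). norm (C * (indicator {0..T} (fst (t, x)) * (?n (fst (snd (t, x))) * ?n (snd (snd (t, x)))))))"
        using iT by (simp add: abs_mult)
    qed (use nn in auto)
    show "(\<lambda>x. indicator ?D x * ?f x) \<in> borel_measurable (lborel \<Otimes>\<^sub>M (lborel \<Otimes>\<^sub>M lborel))"
      unfolding kern_def z_ext_cov_def case_prod_unfold by measurable
    show "AE x in lborel \<Otimes>\<^sub>M (lborel \<Otimes>\<^sub>M lborel). norm (indicator ?D x * ?f x)
        \<le> norm (C * (indicator {0..T} (fst x) * (?n (fst (snd x)) * ?n (snd (snd x)))))"
    proof (rule AE_I2)
      fix x :: "real \<times> real \<times> real"
      obtain t \<tau> s where x: "x = (t, \<tau>, s)" by (cases x)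
      show "norm (indicator ?D x * ?f x) \<le> norm (C * (indicator {0..T} (fst x) * (?n (fst (snd x)) * ?n (snd (snd x)))))"
        using C(1) mult_mono[OF C(2) abs_z_ext_cov_le[of s \<tau>], of t \<tau> s] unfolding x
        by (auto simp: indicator_def abs_mult z_ext_norm_nonneg mult.commute)
    qed
  qed
qed

lemma state_moment_z_ext_mean_integrable: "integrable lborel (\<lambda>t. indicator {0..T} t * state_moment z_ext_mean t)"
proof -
  interpret L3: pair_sigma_finite lborel "lborel \<Otimes>\<^sub>M lborel :: (real \<times> real) measure" ..
  note int = kern_cov_integrable
  let ?F = "\<lambda>t x. indicator {(t, \<tau>, s). 0 \<le> t \<and> t \<le> T \<and> 0 \<le> \<tau> \<and> \<tau> \<le> t \<and> 0 \<le> s \<and> s \<le> t} (t, x)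
    * (kern t (fst x) (snd x) * z_ext_cov (snd x) (fst x))"
  have "integrable lborel (\<lambda>t. LINT x|(lborel \<Otimes>\<^sub>M lborel). ?F t x)"
    using L3.integrable_fst'[OF int] by simp
  moreover have "AE t in lborel. (LINT x|(lborel \<Otimes>\<^sub>M lborel). ?F t x) = indicator {0..T} t * state_moment z_ext_mean t"
    using L3.AE_integrable_fst'[OF int]
  proof eventually_elim
    case (elim t)
    then have "integrable (lborel \<Otimes>\<^sub>M lborel) (?F t)" by simp
    from lborel_pair.integral_fst'[OF this]
    have "(LINT x|(lborel \<Otimes>\<^sub>M lborel). ?F t x) = (LBINT \<tau>. LBINT s. ?F t (\<tau>, s))" by simp
    also have "\<dots> = indicator {0..T} t * state_moment z_ext_mean t"
      unfolding state_moment_z_ext_mean set_lebesgue_integral_def integral_scaleR_right[symmetric]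
        integral_mult_right_zero[symmetric]
      by (intro Bochner_Integration.integral_cong refl) (auto simp: indicator_def)
    finally show ?case .
  qed
  ultimately show ?thesis
    by (intro integrable_cong_AE_imp[where f="\<lambda>t. indicator {0..T} t * state_moment z_ext_mean t"]) auto
qed

lemma expectation_z_eq: "t \<in> {0..T} \<Longrightarrow> expectation (z t) = z_ext_mean t"
  by (simp add: z_ext_mean_def z_ext_eq)

lemma J2_mean: "J2 M T a W z (\<lambda>t. expectation (z t)) = (\<integral>\<^sup>+t\<in>{0..T}. ennreal (state_moment z_ext_mean t / 2) \<partial>lborel)"
proof (rule J2_eq_state_moment(1)[OF z_ext_mean_measurable z_ext_mean_integrable])
  have "(\<lambda>s. indicator {0..T} s * expectation (z s)) = (\<lambda>s. indicator {0..T} s * z_ext_mean s)"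
    by (auto simp: indicator_def expectation_z_eq)
  moreover have "(\<lambda>s. indicator {0..T} s * z_ext_mean s) \<in> borel_measurable lebesgue"
    by (intro measurable_completion) measurable
  ultimately show "(\<lambda>s. indicator {0..T} s * expectation (z s)) \<in> borel_measurable lebesgue" by simp
  show "AE s in lborel. s \<in> {0..T} \<longrightarrow> expectation (z s) = z_ext_mean s"
    by (simp add: expectation_z_eq)
qed

lemma state_moment_z_ext_mean_nonneg: "t \<in> {0..T} \<Longrightarrow> 0 \<le> state_moment z_ext_mean t"
  by (rule J2_eq_state_moment(2)[OF z_ext_mean_measurable z_ext_mean_integrable _ _, of z_ext_mean])
    (auto intro!: measurable_completion)

lemma J2_mean_eq_integral:
  "J2 M T a W z (\<lambda>t. expectation (z t)) = ennreal (1 / 2 * (LBINT t:{0..T}. state_moment z_ext_mean t))"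
proof -
  have "J2 M T a W z (\<lambda>t. expectation (z t)) = (\<integral>\<^sup>+t. ennreal (1 / 2 * (indicator {0..T} t * state_moment z_ext_mean t)) \<partial>lborel)"
    unfolding J2_mean by (intro nn_integral_cong) (auto simp: indicator_def)
  also have "\<dots> = ennreal (LBINT t. 1 / 2 * (indicator {0..T} t * state_moment z_ext_mean t))"
    using state_moment_z_ext_mean_integrable state_moment_z_ext_mean_nonneg
    by (intro nn_integral_eq_integral) (auto simp: indicator_def)
  finally show ?thesis by (simp add: set_lebesgue_integral_def)
qed

lemma mean_in_L1: "(\<lambda>t. expectation (z t)) \<in> L1_fun T"
proof -
  have "integrable lebesgue (\<lambda>s. indicator {0..T} s * z_ext_mean s)"
    using z_ext_mean_integrable by (subst integrable_completion) (auto simp: set_integrable_def)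
  also have "(\<lambda>s. indicator {0..T} s * z_ext_mean s) = (\<lambda>s. indicator {0..T} s * expectation (z s))"
    by (auto simp: indicator_def expectation_z_eq)
  finally show ?thesis by (simp add: L1_fun_def integrable_restrict_space)
qed

text \<open>
  The cost of a control is the cost of \<open>E z\<close> plus a nonnegative excess; minimality and uniqueness are
  both read off from this.
\<close>

lemma J2_excess:
  assumes u: "u \<in> L1_fun T"
  obtains u' where "u' \<in> borel_measurable borel" "set_integrable lborel {0..T} u'"
    "AE s in lborel. s \<in> {0..T} \<longrightarrow> u s = u' s"
    "J2 M T a W z u = J2 M T a W z (\<lambda>t. expectation (z t)) + (\<integral>\<^sup>+t\<in>{0..T}. ennreal (excess u' t / 2) \<partial>lborel)"
proof -
  obtain u' where u'[measurable]: "u' \<in> borel_measurable borel" and int: "integrable lborel u'"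
    and ae: "AE s in lborel. s \<in> {0..T} \<longrightarrow> u s = u' s"
    using L1_fun_borel_version[OF u] by blast
  have si: "set_integrable lborel {0..T} u'"
    unfolding set_integrable_def using int by (intro integrable_mult_indicator) auto
  have "integrable lebesgue (\<lambda>s. indicator {0..T} s * u s)"
    using u by (simp add: L1_fun_def integrable_restrict_space)
  then have "(\<lambda>s. indicator {0..T} s * u s) \<in> borel_measurable lebesgue" by auto
  from J2_eq_state_moment(1)[OF u' si this ae]
  have "J2 M T a W z u = (\<integral>\<^sup>+t\<in>{0..T}. ennreal (state_moment u' t / 2) \<partial>lborel)" .
  also have "\<dots> = (\<integral>\<^sup>+t. ennreal (state_moment z_ext_mean t / 2) * indicator {0..T} t + ennreal (excess u' t / 2) * indicator {0..T} t \<partial>lborel)"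
    by (intro nn_integral_cong)
      (auto simp: indicator_def state_moment_decomposition[OF u' si] add_divide_distrib
        ennreal_plus state_moment_z_ext_mean_nonneg excess_nonneg)
  also have "\<dots> = J2 M T a W z (\<lambda>t. expectation (z t)) + (\<integral>\<^sup>+t\<in>{0..T}. ennreal (excess u' t / 2) \<partial>lborel)"
    unfolding J2_mean by (intro nn_integral_add) measurable
  finally show ?thesis using that[OF u' si ae] by simp
qed

lemma mean_minimizes: "is_arg_min (J2 M T a W z) (\<lambda>u. u \<in> L1_fun T) (\<lambda>t. expectation (z t))"
proof -
  have "J2 M T a W z (\<lambda>t. expectation (z t)) \<le> J2 M T a W z u" if "u \<in> L1_fun T" for u
    by (rule J2_excess[OF that]) simp
  then show ?thesis
    using mean_in_L1 by (auto simp: is_arg_min_def not_less)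
qed

text \<open>
  A minimizer has zero excess cost, since the minimal cost, being finite, can be cancelled.
\<close>

lemma minimizer_unique:
  assumes "is_arg_min (J2 M T a W z) (\<lambda>u. u \<in> L1_fun T) u"
  shows "AE t in lebesgue_on {0..T}. u t = expectation (z t)"
proof -
  let ?m = "\<lambda>t. expectation (z t)"
  have u: "u \<in> L1_fun T" and le: "J2 M T a W z u \<le> J2 M T a W z ?m"
    using assms mean_in_L1 by (auto simp: is_arg_min_def not_less)
  obtain u' where u'[measurable]: "u' \<in> borel_measurable borel" and si: "set_integrable lborel {0..T} u'"
    and ae: "AE s in lborel. s \<in> {0..T} \<longrightarrow> u s = u' s"
    and J: "J2 M T a W z u = J2 M T a W z ?m + (\<integral>\<^sup>+t\<in>{0..T}. ennreal (excess u' t / 2) \<partial>lborel)"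
    by (rule J2_excess[OF u])
  have "J2 M T a W z ?m + (\<integral>\<^sup>+t\<in>{0..T}. ennreal (excess u' t / 2) \<partial>lborel) \<le> J2 M T a W z ?m + 0"
    using le unfolding J by simp
  then have "(\<integral>\<^sup>+t\<in>{0..T}. ennreal (excess u' t / 2) \<partial>lborel) = 0"
    unfolding ennreal_add_left_cancel_le by (auto simp: J2_mean_eq_integral)
  then have "AE t in lborel. ennreal (excess u' t / 2) * indicator {0..T} t = 0"
    by (subst (asm) nn_integral_0_iff_AE) auto
  then have "AE t in lborel. t \<in> {0..T} \<longrightarrow> excess u' t = 0"
  proof eventually_elim
    case (elim t)
    then show ?case using excess_nonneg[of u' t] by (auto simp: ennreal_eq_0_iff)
  qed
  from excess_AE_zero_imp[OF u' si this] ae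
  have "AE s in lborel. s \<in> {0..T} \<longrightarrow> u s = ?m s"
    by eventually_elim (auto simp: expectation_z_eq)
  then show ?thesis
    by (subst AE_restrict_space_iff) (auto intro: AE_completion)
qed

lemma kernel_eq:
  assumes "t \<in> {0..T}" "s \<in> {0..t}" "\<tau> \<in> {0..t}"
  shows "exp (2 * A_int a t - A_int a s - A_int a \<tau> + t - max s \<tau>) * covariance (z s) (z \<tau>) = kern t \<tau> s * z_ext_cov s \<tau>"
proof -
  have "s \<in> {0..T}" "\<tau> \<in> {0..T}" using assms by auto
  then show ?thesis
    using assms(1) by (simp add: kern_def covariance_def z_ext_cov_def z_ext_mean_def A_ext_eq z_ext_eq del: atLeastAtMost_iff)
qed

lemma kernel_set_integrable:
  "set_integrable lebesgue {(t, \<tau>, s). 0 \<le> t \<and> t \<le> T \<and> 0 \<le> \<tau> \<and> \<tau> \<le> t \<and> 0 \<le> s \<and> s \<le> t}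
    (\<lambda>(t, \<tau>, s). exp (2 * A_int a t - A_int a s - A_int a \<tau> + t - max s \<tau>) * covariance (z s) (z \<tau>))"
  (is "set_integrable _ ?D ?f")
proof -
  let ?g = "\<lambda>x. indicator ?D x * (kern (fst x) (fst (snd x)) (snd (snd x)) * z_ext_cov (snd (snd x)) (fst (snd x)))"
  have "integrable lborel ?g"
    using kern_cov_integrable unfolding lborel_prod .
  then have "integrable lebesgue ?g"
    by (subst integrable_completion) auto
  also have "?g = (\<lambda>x. indicator ?D x *\<^sub>R ?f x)"
    by (auto simp: indicator_def kernel_eq)
  finally show ?thesis unfolding set_integrable_def .
qed

lemma J2_mean_formula:
  "enn2real (J2 M T a W z (\<lambda>t. expectation (z t))) = 1 / 2 * (LINT t:{0..T}|lebesgue. LINT \<tau>:{0..t}|lebesgue. LINT s:{0..t}|lebesgue.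
    exp (2 * A_int a t - A_int a s - A_int a \<tau> + t - max s \<tau>) * covariance (z s) (z \<tau>))"
proof -
  have s: "(LINT s:{0..t}|lebesgue. exp (2 * A_int a t - A_int a s - A_int a \<tau> + t - max s \<tau>) * covariance (z s) (z \<tau>))
      = (LBINT s:{0..t}. kern t \<tau> s * z_ext_cov s \<tau>)" if "t \<in> {0..T}" "\<tau> \<in> {0..t}" for t \<tau>
  proof -
    have "(LINT s:{0..t}|lebesgue. exp (2 * A_int a t - A_int a s - A_int a \<tau> + t - max s \<tau>) * covariance (z s) (z \<tau>))
      = (LINT s:{0..t}|lebesgue. kern t \<tau> s * z_ext_cov s \<tau>)"
      using that kernel_eq by (intro set_lebesgue_integral_cong) auto
    also have "\<dots> = (LBINT s:{0..t}. kern t \<tau> s * z_ext_cov s \<tau>)"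
      unfolding set_lebesgue_integral_def kern_def z_ext_cov_def by (rule integral_completion) measurable
    finally show ?thesis .
  qed
  have \<tau>: "(LINT \<tau>:{0..t}|lebesgue. LINT s:{0..t}|lebesgue. exp (2 * A_int a t - A_int a s - A_int a \<tau> + t - max s \<tau>) * covariance (z s) (z \<tau>))
      = state_moment z_ext_mean t" if "t \<in> {0..T}" for t
  proof -
    have "(LINT \<tau>:{0..t}|lebesgue. LINT s:{0..t}|lebesgue. exp (2 * A_int a t - A_int a s - A_int a \<tau> + t - max s \<tau>) * covariance (z s) (z \<tau>))
      = (LINT \<tau>:{0..t}|lebesgue. LBINT s:{0..t}. kern t \<tau> s * z_ext_cov s \<tau>)"
      using that s by (intro set_lebesgue_integral_cong) auto
    also have "\<dots> = (LBINT \<tau>:{0..t}. LBINT s:{0..t}. kern t \<tau> s * z_ext_cov s \<tau>)"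
      unfolding set_lebesgue_integral_def kern_def z_ext_cov_def by (rule integral_completion) measurable
    finally show ?thesis by (simp add: state_moment_z_ext_mean)
  qed
  have "(LINT t:{0..T}|lebesgue. LINT \<tau>:{0..t}|lebesgue. LINT s:{0..t}|lebesgue. exp (2 * A_int a t - A_int a s - A_int a \<tau> + t - max s \<tau>) * covariance (z s) (z \<tau>))
    = (LINT t:{0..T}|lebesgue. state_moment z_ext_mean t)"
    using \<tau> by (intro set_lebesgue_integral_cong) auto
  also have "\<dots> = (LBINT t:{0..T}. state_moment z_ext_mean t)"
    unfolding set_lebesgue_integral_def by (rule integral_completion) measurable
  moreover have "0 \<le> (LBINT t:{0..T}. state_moment z_ext_mean t)"
    unfolding set_lebesgue_integral_def using state_moment_z_ext_mean_nonneg
    by (intro Bochner_Integration.integral_nonneg) (auto simp: indicator_def)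
  ultimately show ?thesis
    unfolding J2_mean_eq_integral by simp
qed

end

theorem proposition6p4:
  fixes M :: "'a measure" and F :: "real \<Rightarrow> 'a measure" and W z :: "real \<Rightarrow> 'a \<Rightarrow> real"
    and a :: "real \<Rightarrow> real" and T p :: real
  defines "ubar \<equiv> (\<lambda>t. prob_space.expectation M (z t))"
    and "K \<equiv> (\<lambda>t \<tau> s. exp (2 * A_int a t - A_int a s - A_int a \<tau> + t - max s \<tau>)
               * prob_space.covariance M (z s) (z \<tau>))"
  assumes "T > 0"
    and "brownian_motion M F W"
    and "a \<in> Linf_fun T"
    and z_adapted: "\<And>t. t \<in> {0..T} \<Longrightarrow> z t \<in> borel_measurable (F t)"
    and z_jointly_measurable:
      "(\<lambda>(t, \<omega>). z t \<omega>) \<in> borel_measurable (restrict_space borel {0..T} \<Otimes>\<^sub>M M)"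
    and "p > 2"
    and z_Lp: "\<And>t. t \<in> {0..T} \<Longrightarrow> integrable M (\<lambda>\<omega>. \<bar>z t \<omega>\<bar> powr p)"
    and z_L2_Lp: "(\<integral>\<^sup>+t\<in>{0..T}.
        ennreal (prob_space.expectation M (\<lambda>\<omega>. \<bar>z t \<omega>\<bar> powr p) powr (2 / p)) \<partial>lebesgue) < \<infinity>"
    and z_indep_W: "prob_space.indep_var M
        (Pi\<^sub>M {0..T} (\<lambda>_. borel)) (\<lambda>\<omega>. \<lambda>t\<in>{0..T}. z t \<omega>)
        (Pi\<^sub>M {0..} (\<lambda>_. borel)) (\<lambda>\<omega>. \<lambda>t\<in>{0..}. W t \<omega>)"
  shows "is_arg_min (J2 M T a W z) (\<lambda>u. u \<in> L1_fun T) ubar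
    \<and> (\<forall>u. is_arg_min (J2 M T a W z) (\<lambda>u. u \<in> L1_fun T) u
          \<longrightarrow> (AE t in lebesgue_on {0..T}. u t = ubar t))
    \<and> J2 M T a W z ubar < \<infinity>
    \<and> set_integrable lebesgue {(t, \<tau>, s). 0 \<le> t \<and> t \<le> T \<and> 0 \<le> \<tau> \<and> \<tau> \<le> t \<and> 0 \<le> s \<and> s \<le> t}
        (\<lambda>(t, \<tau>, s). K t \<tau> s)
    \<and> enn2real (J2 M T a W z ubar) =
        1 / 2 * (LINT t:{0..T}|lebesgue. LINT \<tau>:{0..t}|lebesgue. LINT s:{0..t}|lebesgue. K t \<tau> s)"
proof -
  interpret bm: brownian_motion M F W by fact
  interpret independent_source M F W z a T p
    by (unfold_locales) (fact assms)+
  show ?thesis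
    unfolding ubar_def K_def
    using mean_minimizes minimizer_unique J2_mean_eq_integral kernel_set_integrable J2_mean_formula
    by (intro conjI allI impI) auto
qed

end
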